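(* For any convergent tree $T\in\mathcal{PT}^{\mathrm{conv}}_{\mathbb N^*}$, $$T\mathbin{\mathrm{qsh}^T}[1]-(\mathfrak s^{PT})^{-1}\big(\mathfrak s^{PT}(T)\mathbin{\mathrm{sh}^T}[y]\big)\in\ker(\zeta^T).$$
   Context: $\mathbb K$ is a subfield of $\mathbb R$ (e.g. $\mathbb Q$); $\mathbb N^*=\{1,2,3,\dots\}$. A planar rooted tree is a finite rooted tree in which the children of every vertex are linearly ordered. $\mathrm{PT}_\Omega$ is the set of non-empty planar rooted trees with vertices decorated by a set $\Omega$, $\mathcal{PT}_\Omega$ the $\mathbb K$-vector space with basis $\mathrm{PT}_\Omega$. $B_+^a(T_1\cdots T_k)$ is the tree obtained by grafting $T_1,\dots,T_k$ in this order on a new root decorated by $a$ (extended multilinearly), and $[a]:=B_+^a(\emptyset)$ is the one-vertex tree. Forests are finite, possibly empty, ordered sequences of trees. A ladder tree is a tree in which every vertex has at most one child. Tree products. For $S=B_+^a(S_1\cdots S_k)$, $T=B_+^b(T_1\cdots T_\ell)$, $k,\ell\ge0$, define by induction on the total number of vertices and bilinearity $S<T:=B_+^a(S_1\cdots S_{k-1}(S_k\ast T))$ if $k\ge1$, $B_+^a(T)$ if $k=0$; $S>T:=B_+^b((S\ast T_1)T_2\cdots T_\ell)$ if $\ell\ge1$, $B_+^b(S)$ if $\ell=0$; $S\bullet T:=B_+^{a+b}(S_1\cdots S_{k-1}(S_k\ast T_1)T_2\cdots T_\ell)$ if $k,\ell\ge1$, $B_+^{a+b}(T_1\cdots T_\ell)$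 if $k=0$, $B_+^{a+b}(S_1\cdots S_k)$ if $\ell=0$. On $\mathcal{PT}_{\{x,y\}}$, $\ast=\mathrm{sh}^T:={<}+{>}$. On $\mathcal{PT}_{\mathbb N^*}$, $\ast=\mathrm{qsh}^T:={<}+{>}+\bullet$. Arborified zeta values. Order $V(t)$ with the root as minimum. $\mathcal{PT}^{\mathrm{conv}}_{\mathbb N^*}\subset\mathcal{PT}_{\mathbb N^*}$ is spanned by the trees whose root is not decorated by $1$ (convergent trees); $\zeta^T:\mathcal{PT}^{\mathrm{conv}}_{\mathbb N^*}\to\mathbb R$ is the linear map given on a tree $t$ with decorations $(n_v)$ by the convergent series $\zeta^T(t)=\sum\prod_{v\in V(t)}k_v^{-n_v}$ over all $(k_v)\in(\mathbb N^* )^{V(t)}$ with $k_v<k_u$ whenever $u<v$. Branched binarisation. $\mathfrak s^{PN}:\mathcal{PT}_{\mathbb N^*}\to\mathcal{PT}_{\{x,y\}}$ is the linear map with $\mathfrak s^{PN}(B_+^n(T_1\cdots T_k))=(B_+^x)^{\circ(n-1)}\circ B_+^y(\mathfrak s^{PN}(T_1)\cdots\mathfrak s^{PN}(T_k))$. Process trees. A non-ladder tree $T\in\mathrm{PT}_{\mathbb N^*}$ is uniquely $T=B_+^{n_1}\circ\cdots\circ B_+^{n_p}\big(B_+^{n_a}(F_a)B_+^{n_b}(F_b)F\big)$ with $p\ge1$ and $F_a,F_b,F$ possibly empty forests. Write $B:=B_+^{n_1}\circ\cdots\circ B_+^{n_p}$ and set $T^a_b:=B(B_+^{n_a}(B_+^{n_b}(F_b)F_a)F)$,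 $T^b_a:=B(B_+^{n_b}(B_+^{n_a}(F_a)F_b)F)$, $T_{a+b}:=B(B_+^{n_a+n_b}(F_aF_b)F)$. The process tree $\mathrm{pr}(T)$ is the planar rooted tree with vertices decorated by trees (decoration map $\delta_{\mathrm{pr}(T)}$) defined by the well-founded recursion: a single vertex decorated by $T$ if $T$ is a ladder tree; otherwise root decorated by $T$ with the three children subtrees $\mathrm{pr}(T_{a+b}),\mathrm{pr}(T^a_b),\mathrm{pr}(T^b_a)$. Error term. $T^e=0$ if $T$ is a ladder tree; otherwise, with the notation above, $$T^e=T_{a+b}-\sum_{i=1}^{n_a-1}\binom{n_a-i+n_b-1}{n_b-1}B\big(B_+^{n_a+n_b-i}(B_+^i(F_a)F_b)F\big)-\sum_{i=1}^{n_b-1}\binom{n_b-i+n_a-1}{n_a-1}B\big(B_+^{n_a+n_b-i}(B_+^i(F_b)F_a)F\big).$$ Define linear maps by $\phi(T)=T+\sum_{v\in V(\mathrm{pr}(T))}(\delta_{\mathrm{pr}(T)}(v))^e$ on $\mathcal{PT}_{\mathbb N^*}$ and $\mathfrak s^{PT}:=\mathfrak s^{PN}\circ\phi:\mathcal{PT}_{\mathbb N^*}\to\mathcal{PT}_{\{x,y\}}$. Well-definedness. $\mathfrak s^{PT}$ is a bijection from $\mathcal{PT}_{\mathbb N^*}$ onto the span of the trees in $\mathrm{PT}_{\{x,y\}}$ all of whose leaves and branching vertices (vertices with at least two children) are decorated by $y$; this span is closed under $\mathrm{sh}^T$ and contains $[y]$, so $(\mathfrak s^{PT})^{-1}$ in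 the claim makes sense. Moreover the element in the claim belongs to $\mathcal{PT}^{\mathrm{conv}}_{\mathbb N^*}$. *)

theory Defs
  imports
    "HOL-Analysis.Analysis"
    "HOL-Analysis.Finite_Function_Topology"
    "HOL-Library.Sublist"
begin

datatype 'a ptree = Node (label: 'a) (children: "'a ptree list")

datatype letter = X | Y

definition PT :: "'a set \<Rightarrow> 'a ptree set"
  where "PT \<Omega> = {t. set_ptree t \<subseteq> \<Omega>}"

text \<open>Decorations by positive integers are natural numbers constrained through \<open>PT pos_nats\<close>;
  the values of the operations below at decorations equal to \<open>0\<close> are irrelevant.\<close>

definition pos_nats :: "nat set"
  where "pos_nats = {1..}"

definition real_subfield :: "real set \<Rightarrow> bool"
  where "real_subfield K \<longleftrightarrow>
    1 \<in> K \<and> (\<forall>x\<in>K. \<forall>y\<in>K. x - y \<in> K \<and> x * y \<in> K) \<and> (\<forall>x\<in>K. x \<noteq> 0 \<longrightarrow> inverse x \<in> K)"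

text \<open>Linear combinations of trees are finitely supported functions. The products and maps between these spaces are
  given by integer structure constants, so they are defined once, over the reals, and the vector
  space over a subfield \<open>K\<close> with basis \<open>B\<close> is the subset \<open>span_over K B\<close>.\<close>

definition span_over :: "real set \<Rightarrow> 'b set \<Rightarrow> ('b \<Rightarrow>\<^sub>0 real) set"
  where "span_over K B = {p. Poly_Mapping.keys p \<subseteq> B \<and> (\<forall>t. Poly_Mapping.lookup p t \<in> K)}"

abbreviation basis_vec :: "'b \<Rightarrow> 'b \<Rightarrow>\<^sub>0 real"
  where "basis_vec t \<equiv> Poly_Mapping.single t 1"

definition lin_ext :: "('b \<Rightarrow> 'v::real_vector) \<Rightarrow> ('b \<Rightarrow>\<^sub>0 real) \<Rightarrow> 'v"
  where "lin_ext f p = (\<Sum>t\<in>Poly_Mapping.keys p. Poly_Mapping.lookup p t *\<^sub>R f t)"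

definition bilin_ext ::
    "('b \<Rightarrow> 'c \<Rightarrow> 'v::real_vector) \<Rightarrow> ('b \<Rightarrow>\<^sub>0 real) \<Rightarrow> ('c \<Rightarrow>\<^sub>0 real) \<Rightarrow> 'v"
  where "bilin_ext f p q = lin_ext (\<lambda>s. lin_ext (f s) q) p"

text \<open>\<open>graft_at a F v G\<close> is the grafting of the word \<open>F v G\<close> on a root decorated by \<open>a\<close>,
  extended linearly in the entry \<open>v\<close>.\<close>

definition graft_at ::
    "'a \<Rightarrow> 'a ptree list \<Rightarrow> ('a ptree \<Rightarrow>\<^sub>0 real) \<Rightarrow> 'a ptree list \<Rightarrow> 'a ptree \<Rightarrow>\<^sub>0 real"
  where "graft_at a F v G = lin_ext (\<lambda>U. basis_vec (Node a (F @ [U] @ G))) v"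

lemma size_mem_less: "t \<in> set ts \<Longrightarrow> size t < Suc (size_list size ts)"
  by (induction ts) auto

lemma size_nth_less [termination_simp]: "i < length ts \<Longrightarrow> size (ts ! i) < Suc (size_list size ts)"
  by (simp add: size_mem_less)

lemma size_hd_last_less:
  "ts \<noteq> [] \<Longrightarrow>
    size (hd ts) < Suc (size_list size ts) \<and> size (last ts) < Suc (size_list size ts)"
  by (simp add: size_mem_less)

function (sequential)
  sh_left :: "letter ptree \<Rightarrow> letter ptree \<Rightarrow> letter ptree \<Rightarrow>\<^sub>0 real" and
  sh_right :: "letter ptree \<Rightarrow> letter ptree \<Rightarrow> letter ptree \<Rightarrow>\<^sub>0 real" and
  sh_tree :: "letter ptree \<Rightarrow> letter ptree \<Rightarrow> letter ptree \<Rightarrow>\<^sub>0 real"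
where
  "sh_left (Node a Ss) T =
     (if Ss = [] then basis_vec (Node a [T])
      else graft_at a (butlast Ss) (sh_tree (last Ss) T) [])"
| "sh_right S (Node b Ts) =
     (if Ts = [] then basis_vec (Node b [S])
      else graft_at b [] (sh_tree S (hd Ts)) (tl Ts))"
| "sh_tree S T = sh_left S T + sh_right S T"
  by pat_completeness auto
termination
  by (relation "Wellfounded.measure (\<lambda>z. case z of
        Inl (S, T) \<Rightarrow> 2 * (size S + size T)
      | Inr (Inl (S, T)) \<Rightarrow> 2 * (size S + size T)
      | Inr (Inr (S, T)) \<Rightarrow> 2 * (size S + size T) + 1)")
    (auto dest!: size_hd_last_less)

function (sequential)
  qsh_left :: "nat ptree \<Rightarrow> nat ptree \<Rightarrow> nat ptree \<Rightarrow>\<^sub>0 real" and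
  qsh_right :: "nat ptree \<Rightarrow> nat ptree \<Rightarrow> nat ptree \<Rightarrow>\<^sub>0 real" and
  qsh_contract :: "nat ptree \<Rightarrow> nat ptree \<Rightarrow> nat ptree \<Rightarrow>\<^sub>0 real" and
  qsh_tree :: "nat ptree \<Rightarrow> nat ptree \<Rightarrow> nat ptree \<Rightarrow>\<^sub>0 real"
where
  "qsh_left (Node a Ss) T =
     (if Ss = [] then basis_vec (Node a [T])
      else graft_at a (butlast Ss) (qsh_tree (last Ss) T) [])"
| "qsh_right S (Node b Ts) =
     (if Ts = [] then basis_vec (Node b [S])
      else graft_at b [] (qsh_tree S (hd Ts)) (tl Ts))"
| "qsh_contract (Node a Ss) (Node b Ts) =
     (if Ss = [] then basis_vec (Node (a + b) Ts)
      else if Ts = [] then basis_vec (Node (a + b) Ss)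
      else graft_at (a + b) (butlast Ss) (qsh_tree (last Ss) (hd Ts)) (tl Ts))"
| "qsh_tree S T = qsh_left S T + qsh_right S T + qsh_contract S T"
  by pat_completeness auto
termination
  by (relation "Wellfounded.measure (\<lambda>z. case z of
        Inl (Inl (S, T)) \<Rightarrow> 2 * (size S + size T)
      | Inl (Inr (S, T)) \<Rightarrow> 2 * (size S + size T)
      | Inr (Inl (S, T)) \<Rightarrow> 2 * (size S + size T)
      | Inr (Inr (S, T)) \<Rightarrow> 2 * (size S + size T) + 1)")
    (auto dest!: size_hd_last_less)

definition sh :: "(letter ptree \<Rightarrow>\<^sub>0 real) \<Rightarrow> (letter ptree \<Rightarrow>\<^sub>0 real) \<Rightarrow> letter ptree \<Rightarrow>\<^sub>0 real"
  where "sh = bilin_ext sh_tree"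

definition qsh :: "(nat ptree \<Rightarrow>\<^sub>0 real) \<Rightarrow> (nat ptree \<Rightarrow>\<^sub>0 real) \<Rightarrow> nat ptree \<Rightarrow>\<^sub>0 real"
  where "qsh = bilin_ext qsh_tree"

text \<open>Vertices are addressed by the sequence of child indices on the path from the root; the
  tree order, with the root as minimum, is then the prefix order on addresses.\<close>

fun verts :: "'a ptree \<Rightarrow> nat list set"
  where "verts (Node a ts) = insert [] (\<Union>i\<in>{..<length ts}. (#) i ` verts (ts ! i))"

fun deco :: "'a ptree \<Rightarrow> nat list \<Rightarrow> 'a"
  where
    "deco (Node a ts) [] = a"
  | "deco (Node a ts) (i # p) = deco (ts ! i) p"

definition zeta_index :: "'a ptree \<Rightarrow> (nat list \<Rightarrow> nat) set"
  where "zeta_index t =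
    {k \<in> verts t \<rightarrow>\<^sub>E pos_nats. \<forall>u\<in>verts t. \<forall>v\<in>verts t. strict_prefix u v \<longrightarrow> k v < k u}"

definition zeta_tree :: "nat ptree \<Rightarrow> real"
  where "zeta_tree t = (\<Sum>\<^sub>\<infinity>k\<in>zeta_index t. \<Prod>v\<in>verts t. 1 / real (k v) ^ deco t v)"

definition conv_trees :: "nat ptree set"
  where "conv_trees = {t \<in> PT pos_nats. label t \<noteq> 1}"

definition zetaT :: "(nat ptree \<Rightarrow>\<^sub>0 real) \<Rightarrow> real"
  where "zetaT = lin_ext zeta_tree"

definition ker_zetaT :: "real set \<Rightarrow> (nat ptree \<Rightarrow>\<^sub>0 real) set"
  where "ker_zetaT K = {p \<in> span_over K conv_trees. zetaT p = 0}"

fun sPN_tree :: "nat ptree \<Rightarrow> letter ptree"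
  where "sPN_tree (Node n ts) = ((\<lambda>t. Node X [t]) ^^ (n - 1)) (Node Y (map sPN_tree ts))"

definition sPN :: "(nat ptree \<Rightarrow>\<^sub>0 real) \<Rightarrow> letter ptree \<Rightarrow>\<^sub>0 real"
  where "sPN = lin_ext (\<lambda>t. basis_vec (sPN_tree t))"

fun ladder :: "'a ptree \<Rightarrow> bool"
  where "ladder (Node a ts) \<longleftrightarrow> length ts \<le> 1 \<and> (\<forall>t\<in>set ts. ladder t)"

text \<open>\<open>trunk T\<close> lists the decorations from the root up to the first vertex that does not have
  exactly one child, and \<open>crown T\<close> is the forest of children of that vertex.\<close>

fun trunk :: "'a ptree \<Rightarrow> 'a list"
  where "trunk (Node a ts) = a # (case ts of [t] \<Rightarrow> trunk t | _ \<Rightarrow> [])"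

fun crown :: "'a ptree \<Rightarrow> 'a ptree list"
  where "crown (Node a ts) = (case ts of [t] \<Rightarrow> crown t | _ \<Rightarrow> ts)"

fun graft_trunk :: "'a list \<Rightarrow> 'a ptree list \<Rightarrow> 'a ptree"
  where
    "graft_trunk [] F = undefined"
  | "graft_trunk [a] F = Node a F"
  | "graft_trunk (a # ns) F = Node a [graft_trunk ns F]"

lemma trunk_ne_Nil [simp]: "trunk T \<noteq> []"
  by (cases T) simp

lemma graft_trunk_Cons: "ns \<noteq> [] \<Longrightarrow> graft_trunk (a # ns) F = Node a [graft_trunk ns F]"
  by (cases ns) auto

lemma graft_trunk_trunk_crown: "graft_trunk (trunk T) (crown T) = T"
  by (induction T rule: crown.induct) (auto split: list.splits simp: graft_trunk_Cons)

lemma crown_not_ladder: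
  assumes "\<not> ladder T"
  obtains na Fa nb Fb F where "crown T = Node na Fa # Node nb Fb # F"
proof -
  have "\<exists>A B F. crown T = A # B # F"
    using assms
  proof (induction T rule: crown.induct)
    case (1 a ts)
    then show ?case
      by (cases ts; cases "tl ts") auto
  qed
  then show thesis
    using that by (metis ptree.exhaust)
qed

text \<open>For non-ladder trees, the three functions below give \<open>T\<^sub>a\<^sub>+\<^sub>b\<close>, \<open>T\<^sup>a\<^sub>b\<close> and \<open>T\<^sup>b\<^sub>a\<close>;
  their values at ladder trees are never used.\<close>

definition T_sum :: "nat ptree \<Rightarrow> nat ptree"
  where "T_sum T = (case crown T of
      Node na Fa # Node nb Fb # F \<Rightarrow> graft_trunk (trunk T) (Node (na + nb) (Fa @ Fb) # F)
    | _ \<Rightarrow> T)"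

definition T_ab :: "'a ptree \<Rightarrow> 'a ptree"
  where "T_ab T = (case crown T of
      Node na Fa # Node nb Fb # F \<Rightarrow> graft_trunk (trunk T) (Node na (Node nb Fb # Fa) # F)
    | _ \<Rightarrow> T)"

definition T_ba :: "'a ptree \<Rightarrow> 'a ptree"
  where "T_ba T = (case crown T of
      Node na Fa # Node nb Fb # F \<Rightarrow> graft_trunk (trunk T) (Node nb (Node na Fa # Fb) # F)
    | _ \<Rightarrow> T)"

text \<open>Termination of the process: \<open>incomp\<close> counts unordered pairs of incomparable vertices,
  \<open>nv\<close> counts vertices.\<close>

fun nv :: "'a ptree \<Rightarrow> nat" and nvs :: "'a ptree list \<Rightarrow> nat" where
  "nv (Node a ts) = Suc (nvs ts)"
| "nvs [] = 0"
| "nvs (t # ts) = nv t + nvs ts"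

fun incomp :: "'a ptree \<Rightarrow> nat" and incomps :: "'a ptree list \<Rightarrow> nat" where
  "incomp (Node a ts) = incomps ts"
| "incomps [] = 0"
| "incomps (t # ts) = incomp t + nv t * nvs ts + incomps ts"

lemma nvs_append: "nvs (F @ G) = nvs F + nvs G"
  by (induction F) auto

lemma incomps_append: "incomps (F @ G) = incomps F + nvs F * nvs G + incomps G"
  by (induction F) (auto simp: nvs_append algebra_simps)

lemma nv_graft_trunk: "ns \<noteq> [] \<Longrightarrow> nv (graft_trunk ns F) = length ns + nvs F"
  by (induction ns F rule: graft_trunk.induct) auto

lemma incomp_graft_trunk: "ns \<noteq> [] \<Longrightarrow> incomp (graft_trunk ns F) = incomps F"
  by (induction ns F rule: graft_trunk.induct) auto

lemma process_decreases:
  assumes "\<not> ladder T"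
  shows "incomp (T_sum T) + nv (T_sum T) < incomp T + nv T"
    and "incomp (T_ab T) + nv (T_ab T) < incomp T + nv T"
    and "incomp (T_ba T) + nv (T_ba T) < incomp T + nv T"
proof -
  obtain na Fa nb Fb F where c: "crown T = Node na Fa # Node nb Fb # F"
    using crown_not_ladder[OF assms] .
  have i: "incomp T = incomps (crown T)" and n: "nv T = length (trunk T) + nvs (crown T)"
    using incomp_graft_trunk[of "trunk T" "crown T"] nv_graft_trunk[of "trunk T" "crown T"]
    by (simp_all add: graft_trunk_trunk_crown)
  show "incomp (T_sum T) + nv (T_sum T) < incomp T + nv T"
    and "incomp (T_ab T) + nv (T_ab T) < incomp T + nv T"
    and "incomp (T_ba T) + nv (T_ba T) < incomp T + nv T"
    by (simp_all add: i n c T_sum_def T_ab_def T_ba_def incomp_graft_trunk nv_graft_trunk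
        nvs_append incomps_append algebra_simps)
qed

function process :: "nat ptree \<Rightarrow> nat ptree ptree"
  where "process T =
    (if ladder T then Node T [] else Node T [process (T_sum T), process (T_ab T), process (T_ba T)])"
  by pat_completeness auto
termination
  by (relation "Wellfounded.measure (\<lambda>T. incomp T + nv T)") (auto simp: process_decreases)

declare process.simps [simp del]

definition err :: "nat ptree \<Rightarrow> nat ptree \<Rightarrow>\<^sub>0 real"
  where "err T = (case crown T of
      Node na Fa # Node nb Fb # F \<Rightarrow>
        basis_vec (T_sum T)
        - (\<Sum>i=1..na-1. real ((na - i + nb - 1) choose (nb - 1)) *\<^sub>R
             basis_vec (graft_trunk (trunk T) (Node (na + nb - i) (Node i Fa # Fb) # F)))
        - (\<Sum>i=1..nb-1. real ((nb - i + na - 1) choose (na - 1)) *\<^sub>R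
             basis_vec (graft_trunk (trunk T) (Node (na + nb - i) (Node i Fb # Fa) # F)))
    | _ \<Rightarrow> 0)"

lemma err_ladder: "ladder T \<Longrightarrow> err T = 0"
proof -
  assume "ladder T"
  then have "crown T = []"
    by (induction T rule: crown.induct) (auto split: list.splits)
  then show ?thesis
    by (simp add: err_def)
qed

definition phi_tree :: "nat ptree \<Rightarrow> nat ptree \<Rightarrow>\<^sub>0 real"
  where "phi_tree T = basis_vec T + (\<Sum>v\<in>verts (process T). err (deco (process T) v))"

definition phi :: "(nat ptree \<Rightarrow>\<^sub>0 real) \<Rightarrow> nat ptree \<Rightarrow>\<^sub>0 real"
  where "phi = lin_ext phi_tree"

definition sPT :: "(nat ptree \<Rightarrow>\<^sub>0 real) \<Rightarrow> letter ptree \<Rightarrow>\<^sub>0 real"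
  where "sPT = sPN \<circ> phi"

end

theory Submission
  imports Defs "HOL-Real_Asymp.Real_Asymp"
begin

text \<open>
  Let \<open>z\<^sub>k(T)\<close> be the part of the series \<open>\<zeta>\<^sup>T(T)\<close> in which the root has the value \<open>k\<close>.
  Sending a vertex \<open>x\<close> to integration against \<open>dt/t\<close> and a vertex \<open>y\<close> to integration against
  \<open>dt/(1-t)\<close> turns trees decorated by letters into power series, \<open>sh\<^sup>T\<close> into the product of
  series, and \<open>\<ss>\<^sup>P\<^sup>T(T)\<close> into \<open>\<Sum>\<^sub>k z\<^sub>k(T) t\<^sup>k\<close>: the error terms of the process are exactly
  what replaces the shuffle expansion of a product of iterated integrals by the quasi-shuffle
  expansion of a product of truncated sums. After the common summand \<open>B\<^sub>+\<^sup>1(T)\<close> is cancelled, the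
  remaining part of \<open>T qsh\<^sup>T [1]\<close> has zeta value \<open>\<Sum>\<^sub>k z\<^sub>k(T) H\<^sub>k\<close> with the harmonic numbers
  \<open>H\<^sub>k\<close>, and that of \<open>(\<ss>\<^sup>P\<^sup>T)\<^sup>-\<^sup>1(\<ss>\<^sup>P\<^sup>T(T) sh\<^sup>T [y])\<close> has
  \<open>\<Sum>\<^sub>k \<Sum>\<^sub>j\<^sub><\<^sub>k z\<^sub>j(T) (1/(k-j) - 1/k)\<close>; exchanging the sums gives the same value, because
  \<open>\<Sum>\<^sub>d (1/d - 1/(j+d)) = H\<^sub>j\<close>.
\<close>

section \<open>Linear combinations of trees\<close>

lemma lookup_scaleR [simp]:
  "Poly_Mapping.lookup (c *\<^sub>R p) t = c *\<^sub>R Poly_Mapping.lookup p t"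
proof -
  have "finite {i. c *\<^sub>R Poly_Mapping.lookup p i \<noteq> 0}"
    by (rule finite_subset[of _ "Poly_Mapping.keys p"]) (auto simp: in_keys_iff)
  then show ?thesis
    by (simp add: scaleR_poly_mapping_def)
qed

lemma lin_ext_superset:
  assumes "finite A" "Poly_Mapping.keys p \<subseteq> A"
  shows "lin_ext f p = (\<Sum>t\<in>A. Poly_Mapping.lookup p t *\<^sub>R f t)"
  unfolding lin_ext_def
  by (rule sum.mono_neutral_left) (use assms in \<open>auto simp: in_keys_iff\<close>)

lemma linear_lin_ext: "linear (lin_ext f)"
proof (rule linearI)
  fix p q :: "'a \<Rightarrow>\<^sub>0 real"
  let ?A = "Poly_Mapping.keys p \<union> Poly_Mapping.keys q"
  have "Poly_Mapping.keys (p + q) \<subseteq> ?A"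
    by (rule keys_add)
  then show "lin_ext f (p + q) = lin_ext f p + lin_ext f q"
    by (simp add: lin_ext_superset[of ?A] lookup_add scaleR_left_distrib sum.distrib)
next
  fix r :: real and p :: "'a \<Rightarrow>\<^sub>0 real"
  have "Poly_Mapping.keys (r *\<^sub>R p) \<subseteq> Poly_Mapping.keys p"
    by (auto simp: in_keys_iff)
  then show "lin_ext f (r *\<^sub>R p) = r *\<^sub>R lin_ext f p"
    by (simp add: lin_ext_superset[of "Poly_Mapping.keys p"] scaleR_sum_right)
qed

lemmas lin_ext_add [simp] = linear_add[OF linear_lin_ext]
  and lin_ext_diff [simp] = linear_diff[OF linear_lin_ext]
  and lin_ext_scaleR [simp] = linear_scale[OF linear_lin_ext]
  and lin_ext_sum = linear_sum[OF linear_lin_ext]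
  and lin_ext_zero [simp] = linear_0[OF linear_lin_ext]

lemma lin_ext_basis_vec [simp]: "lin_ext f (basis_vec t) = f t"
  by (simp add: lin_ext_def)

lemma linear_lin_ext_apply: "linear g \<Longrightarrow> g (lin_ext f p) = lin_ext (\<lambda>t. g (f t)) p"
  by (simp add: lin_ext_def linear_sum linear_scale)

lemma lin_ext_cong:
  "(\<And>t. t \<in> Poly_Mapping.keys p \<Longrightarrow> f t = g t) \<Longrightarrow> lin_ext f p = lin_ext g p"
  by (simp add: lin_ext_def)

lemma lin_ext_basis [simp]: "lin_ext (\<lambda>t. basis_vec t) p = p"
proof (rule poly_mapping_eqI)
  fix k
  show "Poly_Mapping.lookup (lin_ext (\<lambda>t. basis_vec t) p) k = Poly_Mapping.lookup p k"
    by (simp add: lin_ext_def lookup_sum lookup_single when_def in_keys_iff if_distrib cong: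
        if_cong)
qed

lemma linear_eq_lin_ext: "linear g \<Longrightarrow> g p = lin_ext (\<lambda>t. g (basis_vec t)) p"
  using linear_lin_ext_apply[of g "\<lambda>t. basis_vec t" p] by simp

lemma lin_ext_add_fun: "lin_ext (\<lambda>t. f t + g t) p = lin_ext f p + lin_ext g p"
  by (simp add: lin_ext_def scaleR_right_distrib sum.distrib)

lemma linear_graft_at: "linear (\<lambda>v. graft_at a F v G)"
  unfolding graft_at_def by (rule linear_lin_ext)

lemma graft_at_basis_vec [simp]: "graft_at a F (basis_vec t) G = basis_vec (Node a (F @ t # G))"
  by (simp add: graft_at_def)

lemma lin_ext_graft_at:
  "lin_ext f (graft_at a F v G) = lin_ext (\<lambda>t. f (Node a (F @ t # G))) v"
  by (simp add: graft_at_def linear_lin_ext_apply[OF linear_lin_ext])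

section \<open>Combinations with coefficients in a subfield\<close>

lemma real_subfieldD:
  assumes "real_subfield K"
  shows real_subfield_0: "0 \<in> K"
    and real_subfield_diff: "x \<in> K \<Longrightarrow> y \<in> K \<Longrightarrow> x - y \<in> K"
    and real_subfield_add: "x \<in> K \<Longrightarrow> y \<in> K \<Longrightarrow> x + y \<in> K"
    and real_subfield_mult: "x \<in> K \<Longrightarrow> y \<in> K \<Longrightarrow> x * y \<in> K"
    and real_subfield_of_nat: "real n \<in> K"
proof -
  have one: "1 \<in> K" using assms by (simp add: real_subfield_def)
  have diff: "x - y \<in> K" if "x \<in> K" "y \<in> K" for x y
    using assms that by (simp add: real_subfield_def)
  show zero: "0 \<in> K" using diff[OF one one] by simp
  have add: "x + y \<in> K" if "x \<in> K" "y \<in> K" for x y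
    using diff[OF \<open>x \<in> K\<close> diff[OF zero \<open>y \<in> K\<close>]] by simp
  show "real n \<in> K" by (induction n) (auto intro: zero add one)
  show "x \<in> K \<Longrightarrow> y \<in> K \<Longrightarrow> x - y \<in> K" "x \<in> K \<Longrightarrow> y \<in> K \<Longrightarrow> x + y \<in> K"
    "x \<in> K \<Longrightarrow> y \<in> K \<Longrightarrow> x * y \<in> K"
    using diff add assms by (auto simp: real_subfield_def)
qed

context
  fixes K :: "real set"
  assumes K: "real_subfield K"
begin

lemma span_over_basis_vec: "t \<in> B \<Longrightarrow> basis_vec t \<in> span_over K B"
  using real_subfield_of_nat[OF K, of 1] real_subfield_0[OF K]
  by (auto simp: span_over_def lookup_single when_def)

lemma span_over_0: "0 \<in> span_over K B"
  using real_subfield_0[OF K] by (simp add: span_over_def)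

lemma span_over_add: "p \<in> span_over K B \<Longrightarrow> q \<in> span_over K B \<Longrightarrow> p + q \<in> span_over K B"
  using real_subfield_add[OF K] keys_add[of p q]
  by (auto simp: span_over_def lookup_add)

lemma span_over_diff: "p \<in> span_over K B \<Longrightarrow> q \<in> span_over K B \<Longrightarrow> p - q \<in> span_over K B"
  using real_subfield_diff[OF K] keys_diff[of p q]
  by (auto simp: span_over_def lookup_minus)

lemma span_over_scaleR: "c \<in> K \<Longrightarrow> p \<in> span_over K B \<Longrightarrow> c *\<^sub>R p \<in> span_over K B"
  using real_subfield_mult[OF K]
  by (auto simp: span_over_def subset_iff in_keys_iff)

lemma span_over_sum: "(\<And>i. i \<in> I \<Longrightarrow> f i \<in> span_over K B) \<Longrightarrow> sum f I \<in> span_over K B"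
  by (induction I rule: infinite_finite_induct) (auto intro: span_over_0 span_over_add)

lemma span_over_lin_ext:
  assumes "p \<in> span_over K A" "\<And>t. t \<in> A \<Longrightarrow> f t \<in> span_over K B"
  shows "lin_ext f p \<in> span_over K B"
  unfolding lin_ext_def
  using assms by (intro span_over_sum span_over_scaleR) (auto simp: span_over_def)

lemma span_over_mono: "A \<subseteq> B \<Longrightarrow> p \<in> span_over K A \<Longrightarrow> p \<in> span_over K B"
  by (auto simp: span_over_def)

lemma span_over_graft_at:
  assumes "v \<in> span_over K A" "\<And>t. t \<in> A \<Longrightarrow> Node a (F @ t # G) \<in> B"
  shows "graft_at a F v G \<in> span_over K B"
  unfolding graft_at_def
  using assms by (intro span_over_lin_ext[OF assms(1)] span_over_basis_vec) auto

text \<open>A basis vector \<open>t\<close> is \<open>g t\<close> minus a combination of vectors of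
  smaller \<open>\<mu>\<close>, and these have preimages by induction on \<open>\<mu>\<close>;
  linearity then gives a preimage of \<open>q\<close>.\<close>

lemma unitriangular_surj:
  fixes \<mu> :: "'b \<Rightarrow> nat"
  assumes g: "\<And>t. t \<in> A \<Longrightarrow> g t - basis_vec t \<in> span_over K {s \<in> A. \<mu> s < \<mu> t}"
    and q: "q \<in> span_over K A"
  obtains p where "p \<in> span_over K A" "lin_ext g p = q"
proof -
  have "\<exists>p\<in>span_over K A. lin_ext g p = basis_vec t" if "t \<in> A" for t
    using that
  proof (induction t rule: measure_induct_rule[of \<mu>])
    case (less t)
    then obtain h where h: "h s \<in> span_over K A \<and> lin_ext g (h s) = basis_vec s"
      if "s \<in> {s \<in> A. \<mu> s < \<mu> t}" for s
      by (metis (no_types, lifting) mem_Collect_eq)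
    let ?p = "basis_vec t - lin_ext h (g t - basis_vec t)"
    have "lin_ext g (lin_ext h (g t - basis_vec t)) = lin_ext (\<lambda>s. basis_vec s) (g t - basis_vec t)"
      unfolding linear_lin_ext_apply[OF linear_lin_ext]
      by (rule lin_ext_cong) (use g[OF less.prems] h in \<open>auto simp: span_over_def\<close>)
    then have "lin_ext g ?p = basis_vec t"
      by (simp del: lin_ext_basis) simp
    moreover have "?p \<in> span_over K A"
      using less.prems h
      by (intro span_over_diff span_over_basis_vec span_over_lin_ext[OF g]) auto
    ultimately show ?case by blast
  qed
  then obtain h where h: "h t \<in> span_over K A \<and> lin_ext g (h t) = basis_vec t" if "t \<in> A" for t
    by metis
  show thesis
  proof
    show "lin_ext h q \<in> span_over K A"
      using h by (intro span_over_lin_ext[OF q]) auto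
    have "lin_ext g (lin_ext h q) = lin_ext (\<lambda>s. basis_vec s) q"
      unfolding linear_lin_ext_apply[OF linear_lin_ext]
      by (rule lin_ext_cong) (use q h in \<open>auto simp: span_over_def\<close>)
    then show "lin_ext g (lin_ext h q) = q" by simp
  qed
qed

text \<open>At a key \<open>m\<close> of maximal \<open>\<mu>\<close> the lower terms of all images
  vanish, so the coefficient of \<open>p\<close> at \<open>m\<close> survives in
  \<open>lin_ext g p\<close>.\<close>

lemma unitriangular_inj:
  fixes \<mu> :: "'b \<Rightarrow> nat"
  assumes g: "\<And>t. t \<in> A \<Longrightarrow> g t - basis_vec t \<in> span_over K {s \<in> A. \<mu> s < \<mu> t}"
    and p: "p \<in> span_over K A" "lin_ext g p = 0"
  shows "p = 0"
proof (rule ccontr)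
  assume "p \<noteq> 0"
  then have "Max (\<mu> ` Poly_Mapping.keys p) \<in> \<mu> ` Poly_Mapping.keys p"
    by (intro Max_in) simp_all
  then obtain m where m: "m \<in> Poly_Mapping.keys p" "\<mu> m = Max (\<mu> ` Poly_Mapping.keys p)"
    by (metis imageE)
  have mx: "\<mu> t \<le> \<mu> m" if "t \<in> Poly_Mapping.keys p" for t
    using that m by simp
  have z: "Poly_Mapping.lookup (g t - basis_vec t) m = 0" if "t \<in> Poly_Mapping.keys p" for t
  proof (rule ccontr)
    assume "Poly_Mapping.lookup (g t - basis_vec t) m \<noteq> 0"
    then have "m \<in> Poly_Mapping.keys (g t - basis_vec t)" by (simp add: in_keys_iff)
    then have "\<mu> m < \<mu> t" using g[of t] that p(1) by (auto simp: span_over_def)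
    with mx[OF that] show False by simp
  qed
  have "lin_ext g p = lin_ext (\<lambda>t. g t - basis_vec t) p + lin_ext (\<lambda>t. basis_vec t) p"
    unfolding lin_ext_add_fun[symmetric] by simp
  then have "Poly_Mapping.lookup (lin_ext (\<lambda>t. g t - basis_vec t) p) m + Poly_Mapping.lookup p m
      = 0"
    using p(2) by (simp flip: lookup_add)
  moreover have "Poly_Mapping.lookup (lin_ext (\<lambda>t. g t - basis_vec t) p) m = 0"
    unfolding lin_ext_def lookup_sum lookup_scaleR by (rule sum.neutral) (use z in simp)
  ultimately show False using m(1) by (simp add: in_keys_iff)
qed

end

section \<open>The branched binarisation maps are triangular\<close>

lemma verts_children: "verts (Node a ts) = insert [] (\<Union>i<length ts. (#) i ` verts (ts ! i))"
  by simp

lemma finite_verts: "finite (verts t)"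
  by (induction t) (auto simp: set_conv_nth)

lemma sum_verts:
  fixes f :: "'a \<Rightarrow> 'v::comm_monoid_add"
  shows "(\<Sum>v\<in>verts (Node a ts). f (deco (Node a ts) v)) = f a + (\<Sum>t\<leftarrow>ts. \<Sum>v\<in>verts t. f (deco t v))"
proof -
  have "(\<Sum>v\<in>verts (Node a ts). f (deco (Node a ts) v))
      = f a + (\<Sum>v\<in>(\<Union>i<length ts. (#) i ` verts (ts ! i)). f (deco (Node a ts) v))"
    unfolding verts_children by (subst sum.insert) (auto simp: finite_verts)
  also have "(\<Sum>v\<in>(\<Union>i<length ts. (#) i ` verts (ts ! i)). f (deco (Node a ts) v))
      = (\<Sum>i<length ts. \<Sum>v\<in>(#) i ` verts (ts ! i). f (deco (Node a ts) v))"
    by (rule sum.UNION_disjoint) (auto simp: finite_verts)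
  also have "\<dots> = (\<Sum>i<length ts. \<Sum>v\<in>verts (ts ! i). f (deco (ts ! i) v))"
    by (rule sum.cong) (simp_all add: sum.reindex)
  also have "\<dots> = (\<Sum>t\<leftarrow>ts. \<Sum>v\<in>verts t. f (deco t v))"
    by (simp add: sum_list_sum_nth atLeast0LessThan)
  finally show ?thesis .
qed

lemma phi_tree_ladder: "ladder T \<Longrightarrow> phi_tree T = basis_vec T"
  by (simp add: phi_tree_def process.simps err_ladder)

text \<open>The root of the process tree contributes \<open>err T\<close>; each child subtree
  contributes its own error sum, which is \<open>phi_tree\<close> minus the basis vector. All later
  statements about \<open>phi_tree\<close> are inductions along this recursion.\<close>

lemma phi_tree_rec:
  assumes "\<not> ladder T"
  shows "phi_tree T = basis_vec T + err T + (phi_tree (T_sum T) - basis_vec (T_sum T))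
    + (phi_tree (T_ab T) - basis_vec (T_ab T)) + (phi_tree (T_ba T) - basis_vec (T_ba T))"
proof -
  have "process T = Node T [process (T_sum T), process (T_ab T), process (T_ba T)]"
    using assms by (subst process.simps) simp
  then show ?thesis
    by (simp add: phi_tree_def sum_verts[of err] del: verts.simps)
qed

lemma non_ladder_graft_trunk:
  assumes "\<not> ladder T"
  obtains ns na Fa nb Fb F where "ns \<noteq> []" "T = graft_trunk ns (Node na Fa # Node nb Fb # F)"
    "trunk T = ns" "crown T = Node na Fa # Node nb Fb # F"
  using crown_not_ladder[OF assms] graft_trunk_trunk_crown[of T] trunk_ne_Nil[of T] by metis

lemma label_graft_trunk: "ns \<noteq> [] \<Longrightarrow> label (graft_trunk ns F) = hd ns"
  by (induction ns F rule: graft_trunk.induct) auto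

lemma set_graft_trunk: "ns \<noteq> [] \<Longrightarrow> set_ptree (graft_trunk ns F) = set ns \<union> (\<Union>t\<in>set F. set_ptree t)"
  by (induction ns F rule: graft_trunk.induct) auto

lemma Node_in_PT_iff: "Node a ts \<in> PT \<Omega> \<longleftrightarrow> a \<in> \<Omega> \<and> set ts \<subseteq> PT \<Omega>"
  by (auto simp: PT_def)

text \<open>The numerical bound is the termination measure of the process. Fixing the root
  decoration makes all corrections of a convergent tree convergent again.\<close>

definition below :: "nat ptree \<Rightarrow> nat ptree set"
  where "below T = {s \<in> PT pos_nats. label s = label T \<and> incomp s + nv s < incomp T + nv T}"

lemma below_trans: "s \<in> below t \<Longrightarrow> t \<in> below u \<Longrightarrow> s \<in> below u"
  by (auto simp: below_def)

lemma T_children_below: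
  assumes "T \<in> PT pos_nats" "\<not> ladder T"
  shows "T_sum T \<in> below T" "T_ab T \<in> below T" "T_ba T \<in> below T"
proof -
  obtain ns na Fa nb Fb F where c: "ns \<noteq> []" "T = graft_trunk ns (Node na Fa # Node nb Fb # F)"
    "trunk T = ns" "crown T = Node na Fa # Node nb Fb # F"
    using non_ladder_graft_trunk[OF assms(2)] .
  have "label T = hd ns"
    unfolding c(2) by (rule label_graft_trunk[OF c(1)])
  moreover have "set_ptree T = set ns \<union> (\<Union>t\<in>set (Node na Fa # Node nb Fb # F). set_ptree t)"
    unfolding c(2) by (rule set_graft_trunk[OF c(1)])
  ultimately show "T_sum T \<in> below T" "T_ab T \<in> below T" "T_ba T \<in> below T"
    using assms(1) process_decreases[OF assms(2)] c(1)
    by (auto simp: below_def T_sum_def T_ab_def T_ba_def c(3,4) label_graft_trunk set_graft_trunk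
        PT_def pos_nats_def)
qed

text \<open>The trees with binomial coefficients have the shapes of \<open>T_ba T\<close> and
  \<open>T_ab T\<close>: the number of vertices is unchanged, but two incomparable vertices are now
  stacked. The ranges of \<open>i\<close> keep the new decorations positive.\<close>

lemma err_below:
  assumes K: "real_subfield K" and "T \<in> PT pos_nats" "\<not> ladder T"
  shows "err T \<in> span_over K (below T)"
proof -
  obtain ns na Fa nb Fb F where c: "ns \<noteq> []" "T = graft_trunk ns (Node na Fa # Node nb Fb # F)"
    "trunk T = ns" "crown T = Node na Fa # Node nb Fb # F"
    using non_ladder_graft_trunk[OF assms(3)] .
  have 1: "graft_trunk ns (Node (na + nb - i) (Node i Fa # Fb) # F) \<in> below T"
    if "i \<in> {1..na - 1}" for i
    using assms(2) c(1) that
    by (auto simp: below_def c(2) label_graft_trunk set_graft_trunk PT_def pos_nats_def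
        incomp_graft_trunk nv_graft_trunk algebra_simps)
  have 2: "graft_trunk ns (Node (na + nb - i) (Node i Fb # Fa) # F) \<in> below T"
    if "i \<in> {1..nb - 1}" for i
    using assms(2) c(1) that
    by (auto simp: below_def c(2) label_graft_trunk set_graft_trunk PT_def pos_nats_def
        incomp_graft_trunk nv_graft_trunk algebra_simps)
  show ?thesis
    unfolding err_def c(3,4) list.case ptree.case
    by (intro span_over_diff[OF K] span_over_sum[OF K] span_over_scaleR[OF K]
        span_over_basis_vec[OF K]
        real_subfield_of_nat[OF K] T_children_below assms 1 2)
qed

lemma phi_tree_unitriangular:
  assumes K: "real_subfield K" and "T \<in> PT pos_nats"
  shows "phi_tree T - basis_vec T \<in> span_over K (below T)"
  using assms(2)
proof (induction T rule: process.induct)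
  case (1 T)
  show ?case
  proof (cases "ladder T")
    case True
    then show ?thesis by (simp add: phi_tree_ladder span_over_0[OF K])
  next
    case False
    note b = T_children_below[OF 1(4) False]
    have sub: "below s \<subseteq> below T" if "s \<in> below T" for s
      using that below_trans by blast
    have pt: "s \<in> PT pos_nats" if "s \<in> below T" for s
      using that by (simp add: below_def)
    note ih = span_over_mono[OF K sub[OF b(1)] 1(1)[OF False pt[OF b(1)]]]
      span_over_mono[OF K sub[OF b(2)] 1(2)[OF False pt[OF b(2)]]]
      span_over_mono[OF K sub[OF b(3)] 1(3)[OF False pt[OF b(3)]]]
    have "phi_tree T - basis_vec T = err T + (phi_tree (T_sum T) - basis_vec (T_sum T))
    + (phi_tree (T_ab T) - basis_vec (T_ab T)) + (phi_tree (T_ba T) - basis_vec (T_ba T))"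
      by (simp add: phi_tree_rec[OF False])
    then show ?thesis
      using ih err_below[OF K 1(4) False] by (simp add: span_over_add[OF K])
  qed
qed

text \<open>The corrections in \<open>phi\<close> preserve the root decoration, so any condition
  \<open>P\<close> on it can be carried along; \<open>n \<noteq> 1\<close> selects the convergent
  trees.\<close>

lemma phi_surj:
  assumes K: "real_subfield K" and "q \<in> span_over K {t \<in> PT pos_nats. P (label t)}"
  obtains p where "p \<in> span_over K {t \<in> PT pos_nats. P (label t)}" "phi p = q"
proof (rule unitriangular_surj[OF K _ assms(2), of phi_tree "\<lambda>T. incomp T + nv T"])
  fix t assume "t \<in> {t \<in> PT pos_nats. P (label t)}"
  then show "phi_tree t - basis_vec t
      \<in> span_over K {s \<in> {t \<in> PT pos_nats. P (label t)}. incomp s + nv s < incomp t + nv t}"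
    by (intro span_over_mono[OF K _ phi_tree_unitriangular[OF K]]) (auto simp: below_def)
qed (use that in \<open>simp add: phi_def\<close>)

lemma phi_in_span:
  assumes K: "real_subfield K" and "p \<in> span_over K {t \<in> PT pos_nats. P (label t)}"
  shows "phi p \<in> span_over K {t \<in> PT pos_nats. P (label t)}"
  unfolding phi_def
proof (rule span_over_lin_ext[OF K assms(2)])
  fix t assume t: "t \<in> {t \<in> PT pos_nats. P (label t)}"
  then have "phi_tree t - basis_vec t \<in> span_over K {t \<in> PT pos_nats. P (label t)}"
    by (intro span_over_mono[OF K _ phi_tree_unitriangular[OF K]]) (auto simp: below_def)
  from span_over_add[OF K this span_over_basis_vec[OF K t]]
  show "phi_tree t \<in> span_over K {t \<in> PT pos_nats. P (label t)}" by simp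
qed

lemma phi_eq_0:
  assumes K: "real_subfield K" and "p \<in> span_over K (PT pos_nats)" "phi p = 0"
  shows "p = 0"
proof (rule unitriangular_inj[OF K _ assms(2), of phi_tree "\<lambda>T. incomp T + nv T"])
  fix t :: "nat ptree" assume "t \<in> PT pos_nats"
  then show "phi_tree t - basis_vec t
      \<in> span_over K {s \<in> PT pos_nats. incomp s + nv s < incomp t + nv t}"
    by (intro span_over_mono[OF K _ phi_tree_unitriangular[OF K]]) (auto simp: below_def)
qed (use assms(3) in \<open>simp add: phi_def\<close>)

section \<open>Decoding binarised trees\<close>

fun sPN_dec :: "letter ptree \<Rightarrow> nat ptree" where
  "sPN_dec (Node Y ts) = Node 1 (map sPN_dec ts)"
| "sPN_dec (Node X ts) = (case map sPN_dec ts of [Node n us] \<Rightarrow> Node (Suc n) us | _ \<Rightarrow> undefined)"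

text \<open>These are the trees whose leaves and branching vertices carry \<open>Y\<close>: a vertex
  \<open>X\<close> is neither, hence has exactly one child. On them the \<open>undefined\<close>
  branch of \<open>sPN_dec\<close> is never reached.\<close>

fun Y_branched :: "letter ptree \<Rightarrow> bool" where
  "Y_branched (Node a ts) \<longleftrightarrow> (a = X \<longrightarrow> length ts = 1) \<and> (\<forall>t\<in>set ts. Y_branched t)"

lemma sPN_dec_funpow: "sPN_dec (((\<lambda>t. Node X [t]) ^^ m) (Node Y ts))
    = Node (Suc m) (map sPN_dec ts)"
  by (induction m) auto

lemma label_funpow_X: "label (((\<lambda>t. Node X [t]) ^^ m) (Node Y ts)) = X \<longleftrightarrow> m \<noteq> 0"
  by (cases m) auto

lemma Y_branched_funpow_X: "Y_branched (((\<lambda>t. Node X [t]) ^^ m) s) \<longleftrightarrow> Y_branched s"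
  by (induction m) auto

lemma sPN_dec_sPN: "t \<in> PT pos_nats \<Longrightarrow> sPN_dec (sPN_tree t) = t"
proof (induction t)
  case (Node n ts)
  then have "sPN_dec (sPN_tree t) = t" if "t \<in> set ts" for t
    using that by (fastforce simp: PT_def)
  then show ?case
    using Node.prems by (auto simp: sPN_dec_funpow PT_def pos_nats_def intro!: map_idI)
qed

lemma Y_branched_sPN: "Y_branched (sPN_tree t)"
  by (induction t) (simp add: Y_branched_funpow_X)

text \<open>A root decoration \<open>n\<close> becomes a chain of \<open>n - 1\<close> vertices
  \<open>X\<close> ending in a \<open>Y\<close>. Convergence is therefore visible as a root
  \<open>X\<close>.\<close>

lemma label_sPN: "t \<in> PT pos_nats \<Longrightarrow> label (sPN_tree t) = X \<longleftrightarrow> label t \<noteq> 1"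
  by (cases t) (auto simp: label_funpow_X PT_def pos_nats_def)

lemma sPN_sPN_dec: "Y_branched s \<Longrightarrow> sPN_dec s \<in> PT pos_nats \<and> sPN_tree (sPN_dec s) = s"
proof (induction s)
  case (Node a ts)
  show ?case
  proof (cases a)
    case Y
    then show ?thesis using Node
      by (auto simp: PT_def pos_nats_def intro!: map_idI)
  next
    case X
    then obtain t where t: "ts = [t]" using Node.prems by (cases ts) auto
    obtain n us where n: "sPN_dec t = Node n us" by (cases "sPN_dec t")
    have ih: "Node n us \<in> PT pos_nats" "sPN_tree (Node n us) = t"
      using Node n unfolding t by auto
    then obtain m where "n = Suc m" by (cases n) (auto simp: PT_def pos_nats_def)
    then show ?thesis using ih X t n by (auto simp: PT_def pos_nats_def)
  qed
qed

lemma sPN_surj: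
  assumes K: "real_subfield K" and q: "q \<in> span_over K {s. Y_branched s \<and> label s = X}"
  obtains p where "p \<in> span_over K {t \<in> PT pos_nats. label t \<noteq> 1}" "sPN p = q"
proof
  show "lin_ext (\<lambda>s. basis_vec (sPN_dec s)) q \<in> span_over K {t \<in> PT pos_nats. label t \<noteq> 1}"
  proof (intro span_over_lin_ext[OF K q] span_over_basis_vec[OF K])
    fix s assume "s \<in> {s. Y_branched s \<and> label s = X}"
    then show "sPN_dec s \<in> {t \<in> PT pos_nats. label t \<noteq> 1}"
      using sPN_sPN_dec[of s] label_sPN[of "sPN_dec s"] by simp
  qed
  have "sPN (lin_ext (\<lambda>s. basis_vec (sPN_dec s)) q) = lin_ext (\<lambda>s. basis_vec s) q"
    unfolding sPN_def linear_lin_ext_apply[OF linear_lin_ext]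
    by (rule lin_ext_cong) (use q sPN_sPN_dec in \<open>auto simp: span_over_def\<close>)
  then show "sPN (lin_ext (\<lambda>s. basis_vec (sPN_dec s)) q) = q" by simp
qed

lemma sPN_eq_0:
  assumes "p \<in> span_over K (PT pos_nats)" "sPN p = 0"
  shows "p = 0"
proof -
  have "lin_ext (\<lambda>s. basis_vec (sPN_dec s)) (sPN p) = lin_ext (\<lambda>s. basis_vec s) p"
    unfolding sPN_def linear_lin_ext_apply[OF linear_lin_ext]
    by (rule lin_ext_cong) (use assms(1) sPN_dec_sPN in \<open>auto simp: span_over_def\<close>)
  then show ?thesis using assms(2) by simp
qed

section \<open>Injectivity and preimages of \<open>sPT\<close>\<close>

lemma linear_sPT: "linear sPT"
  unfolding sPT_def sPN_def phi_def by (intro linear_compose linear_lin_ext)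

lemma sPT_inj:
  assumes K: "real_subfield K"
  shows "inj_on sPT (span_over K (PT pos_nats))"
proof (rule inj_onI)
  fix p q assume p: "p \<in> span_over K (PT pos_nats)" and q: "q \<in> span_over K (PT pos_nats)"
    and "sPT p = sPT q"
  then have "sPN (phi (p - q)) = 0"
    using linear_diff[OF linear_sPT, of p q] by (simp add: sPT_def)
  moreover have d: "p - q \<in> span_over K (PT pos_nats)" using p q by (rule span_over_diff[OF K])
  moreover have "phi (p - q) \<in> span_over K (PT pos_nats)"
    using phi_in_span[OF K, of "p - q" "\<lambda>_. True"] d by simp
  ultimately show "p = q"
    using sPN_eq_0[of "phi (p - q)" K] phi_eq_0[OF K d] by simp
qed

lemma sPT_surj:
  assumes K: "real_subfield K" and q: "q \<in> span_over K {s. Y_branched s \<and> label s = X}"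
  obtains p where "p \<in> span_over K conv_trees" "sPT p = q"
proof -
  obtain r where r: "r \<in> span_over K {t \<in> PT pos_nats. label t \<noteq> 1}" "sPN r = q"
    using sPN_surj[OF K q] .
  obtain p where "p \<in> span_over K {t \<in> PT pos_nats. label t \<noteq> 1}" "phi p = r"
    using phi_surj[OF K, of r "\<lambda>n. n \<noteq> 1"] r(1) by auto
  with r(2) show thesis by (intro that[of p]) (auto simp: conv_trees_def sPT_def)
qed

section \<open>Compatibility with grafting a tree on a new root\<close>

lemma T_children_graft:
  assumes "\<not> ladder t"
  shows "T_sum (Node n [t]) = Node n [T_sum t]" "T_ab (Node n [t]) = Node n [T_ab t]"
    "T_ba (Node n [t]) = Node n [T_ba t]"
proof -
  obtain na Fa nb Fb F where "crown t = Node na Fa # Node nb Fb # F"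
    using crown_not_ladder[OF assms] .
  then show "T_sum (Node n [t]) = Node n [T_sum t]" "T_ab (Node n [t]) = Node n [T_ab t]"
    "T_ba (Node n [t]) = Node n [T_ba t]"
    by (simp_all add: T_sum_def T_ab_def T_ba_def graft_trunk_Cons)
qed

lemma err_graft: "err (Node n [t]) = graft_at n [] (err t) []"
proof (cases "ladder t")
  case True
  then show ?thesis by (simp add: err_ladder linear_0[OF linear_graft_at])
next
  case False
  obtain na Fa nb Fb F where c: "crown t = Node na Fa # Node nb Fb # F"
    using crown_not_ladder[OF False] .
  show ?thesis
    by (simp add: err_def c T_children_graft[OF False] graft_trunk_Cons
        linear_diff[OF linear_graft_at]
        linear_sum[OF linear_graft_at] linear_scale[OF linear_graft_at])
qed

text \<open>A new root with one child lengthens the trunk and leaves the crown alone, so each step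
  of the process and each error term commutes with the grafting.\<close>

lemma phi_tree_graft: "phi_tree (Node n [T]) = graft_at n [] (phi_tree T) []"
proof (induction T rule: process.induct)
  case (1 T)
  show ?case
  proof (cases "ladder T")
    case True
    then show ?thesis by (simp add: phi_tree_ladder)
  next
    case False
    then have "\<not> ladder (Node n [T])" by simp
    from phi_tree_rec[OF this] show ?thesis
      using 1 False
      by (simp add: phi_tree_rec[OF False] T_children_graft err_graft
          linear_diff[OF linear_graft_at]
        linear_add[OF linear_graft_at])
  qed
qed

text \<open>This gives an explicit preimage of the right half of the shuffle with
  \<open>[y]\<close>, the half whose preimage is not convergent.\<close>

lemma sPT_graft_1: "sPT (basis_vec (Node 1 [T])) = graft_at Y [] (sPT (basis_vec T)) []"
  by (simp add: sPT_def sPN_def phi_def phi_tree_graft lin_ext_graft_at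
      linear_lin_ext_apply[OF linear_graft_at])

section \<open>The left half of the shuffle with \<open>[y]\<close>\<close>

lemma sh_left_Y_branched:
  assumes K: "real_subfield K" and "Y_branched s"
  shows "sh_left s (Node Y []) \<in> span_over K {u. Y_branched u \<and> label u = label s}"
  using assms(2)
proof (induction s)
  case (Node a ts)
  show ?case
  proof (cases "ts = []")
    case True
    then show ?thesis using Node.prems by (auto intro: span_over_basis_vec[OF K])
  next
    case False
    let ?s = "last ts"
    have s: "?s \<in> set ts" "Y_branched ?s" using False Node.prems by auto
    have "sh_left ?s (Node Y []) \<in> span_over K {u. Y_branched u}"
      by (rule span_over_mono[OF K _ Node.IH]) (use s in auto)
    then have "sh_tree ?s (Node Y []) \<in> span_over K {u. Y_branched u}"
      using s by (auto intro!: span_over_add[OF K] span_over_basis_vec[OF K])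
    \<comment> \<open>In every term exactly one tree replaces the last child, so a vertex
      \<open>X\<close> keeps its single child.\<close>
    then have "graft_at a (butlast ts) (sh_tree ?s (Node Y [])) []
        \<in> span_over K {u. Y_branched u \<and> label u = a}"
      by (rule span_over_graft_at[OF K]) (use Node.prems False in \<open>auto dest: in_set_butlastD\<close>)
    then show ?thesis using False by (simp del: sh_tree.simps)
  qed
qed

lemma sPT_in_span:
  assumes K: "real_subfield K" and "T \<in> conv_trees"
  shows "sPT (basis_vec T) \<in> span_over K {s. Y_branched s \<and> label s = X}"
proof -
  have "phi (basis_vec T) \<in> span_over K {t \<in> PT pos_nats. label t \<noteq> 1}"
    by (rule phi_in_span[OF K, of _ "\<lambda>n. n \<noteq> 1", OF span_over_basis_vec[OF K]])
      (use assms in \<open>auto simp: conv_trees_def\<close>)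
  then show ?thesis
    unfolding sPT_def sPN_def comp_def
    by (rule span_over_lin_ext[OF K])
      (use Y_branched_sPN label_sPN in \<open>auto intro!: span_over_basis_vec[OF K]\<close>)
qed

text \<open>The shuffle with \<open>[y]\<close> splits into the right half, which is the image of
  \<open>Node 1 [T]\<close>, and the left half, whose trees keep the root \<open>X\<close> and hence
  come from a convergent \<open>U\<close>.\<close>

lemma sh_sPT_inverse:
  assumes K: "real_subfield K" and T: "T \<in> conv_trees"
  obtains U where "U \<in> span_over K conv_trees"
    "sPT U = lin_ext (\<lambda>s. sh_left s (Node Y [])) (sPT (basis_vec T))"
    "inv_into (span_over K (PT pos_nats)) sPT (sh (sPT (basis_vec T)) (basis_vec (Node Y [])))
      = basis_vec (Node 1 [T]) + U"
proof -
  have "lin_ext (\<lambda>s. sh_left s (Node Y [])) (sPT (basis_vec T))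
      \<in> span_over K {s. Y_branched s \<and> label s = X}"
    by (rule span_over_lin_ext[OF K sPT_in_span[OF K T]]) (use sh_left_Y_branched[OF K] in force)
  then obtain U where U: "U \<in> span_over K conv_trees"
    "sPT U = lin_ext (\<lambda>s. sh_left s (Node Y [])) (sPT (basis_vec T))"
    using sPT_surj[OF K] by blast
  have "sh (sPT (basis_vec T)) (basis_vec (Node Y [])) = sPT (basis_vec (Node 1 [T]) + U)"
    by (simp add: sh_def bilin_ext_def linear_add[OF linear_sPT] U(2)
        sPT_graft_1[unfolded One_nat_def] lin_ext_add_fun
        graft_at_def)
  moreover have "basis_vec (Node 1 [T]) + U \<in> span_over K (PT pos_nats)"
    by (rule span_over_add[OF K span_over_basis_vec[OF K] span_over_mono[OF K _ U(1)]])
      (use T in \<open>auto simp: conv_trees_def PT_def pos_nats_def\<close>)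
  ultimately show thesis
    using U by (intro that[of U]) (simp_all add: inv_into_f_f[OF sPT_inj[OF K]])
qed

section \<open>The Euler integration operator\<close>

text \<open>This allows \<open>lin_ext\<close> to take values in power series.\<close>

instantiation fps :: (real_vector) real_vector
begin

definition scaleR_fps :: "real \<Rightarrow> 'a fps \<Rightarrow> 'a fps"
  where "scaleR_fps c f = Abs_fps (\<lambda>n. c *\<^sub>R fps_nth f n)"

instance
  by standard (simp_all add: scaleR_fps_def fps_eq_iff scaleR_right_distrib scaleR_left_distrib)

end

lemma fps_nth_scaleR [simp]: "fps_nth (c *\<^sub>R f) n = c *\<^sub>R fps_nth f n"
  by (simp add: scaleR_fps_def)

lemma fps_scaleR_conv_mult: "c *\<^sub>R (f :: real fps) = fps_const c * f"
  by (simp add: fps_eq_iff)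

lemma fps_mult_scaleR_left: "(c *\<^sub>R (f :: real fps)) * g = c *\<^sub>R (f * g)"
  by (simp add: fps_scaleR_conv_mult mult_ac)

lemma fps_mult_scaleR_right: "(f :: real fps) * (c *\<^sub>R g) = c *\<^sub>R (f * g)"
  by (simp add: fps_scaleR_conv_mult mult_ac)

lemma linear_fps_mult: "linear (\<lambda>f. c * (f :: real fps))"
  by (rule linearI) (simp_all add: distrib_left fps_mult_scaleR_right)

lemma linear_fps_nth: "linear (\<lambda>f. fps_nth (f :: real fps) k)"
  by (rule linearI) simp_all

text \<open>Integration against \<open>dt/t\<close>; the constant coefficient is dropped because of \<open>x/0 = 0\<close>.\<close>

definition euler_int :: "real fps \<Rightarrow> real fps"
  where "euler_int f = Abs_fps (\<lambda>k. fps_nth f k / real k)"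

text \<open>This is \<open>t/(1-t)\<close>, the density of \<open>dt/(1-t)\<close> with respect to
  \<open>dt/t\<close>.\<close>

definition geom_tail :: "real fps"
  where "geom_tail = Abs_fps (\<lambda>k. if k = 0 then 0 else 1)"

lemma euler_int_nth [simp]: "fps_nth (euler_int f) k = fps_nth f k / real k"
  by (simp add: euler_int_def)

lemma euler_int_funpow_nth: "fps_nth ((euler_int ^^ n) f) k = fps_nth f k / real k ^ n"
  by (induction n) auto

lemma geom_tail_nth_0 [simp]: "fps_nth geom_tail 0 = 0"
  by (simp add: geom_tail_def)

text \<open>The missing constant term of \<open>t/(1-t)\<close> makes the bound strict, matching the
  strict inequality between the values at a vertex and its child.\<close>

lemma geom_tail_mult_nth: "fps_nth (geom_tail * f) k = (\<Sum>j<k. fps_nth f j)"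
proof -
  have "fps_nth (f * geom_tail) k = (\<Sum>j=0..k. if j < k then fps_nth f j else 0)"
    unfolding fps_mult_nth geom_tail_def by (rule sum.cong) auto
  also have "\<dots> = (\<Sum>j<k. fps_nth f j)"
    by (rule sum.mono_neutral_cong_right) auto
  finally show ?thesis by (simp add: mult.commute)
qed

lemma linear_euler_int: "linear euler_int"
  by (rule linearI) (simp_all add: fps_eq_iff add_divide_distrib)

lemma linear_euler_int_funpow: "linear (euler_int ^^ n)"
  by (induction n) (use linear_euler_int in \<open>simp_all add: linear_iff\<close>)

lemmas euler_int_simps = linear_add[OF linear_euler_int] linear_scale[OF linear_euler_int]
  linear_sum[OF linear_euler_int]

text \<open>Integration by parts: the derivation \<open>t d/dt\<close> inverts
  \<open>euler_int\<close> on series without constant term.\<close>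

lemma euler_int_mult:
  assumes "fps_nth f 0 = 0" "fps_nth g 0 = 0"
  shows "euler_int f * euler_int g = euler_int (f * euler_int g + euler_int f * g)"
proof (rule fps_ext)
  fix k
  show "fps_nth (euler_int f * euler_int g) k
      = fps_nth (euler_int (f * euler_int g + euler_int f * g)) k"
  proof (cases "k = 0")
    case False
    \<comment> \<open>The Leibniz rule in coefficients: the degree \<open>k\<close> is split as
      \<open>i + (k - i)\<close>.\<close>
    have "real k * fps_nth (euler_int f * euler_int g) k
        = (\<Sum>i=0..k. (real i + real (k - i)) *
            (fps_nth f i / real i * (fps_nth g (k - i) / real (k - i))))"
      by (simp add: fps_mult_nth sum_distrib_left)
    also have "\<dots> = (\<Sum>i=0..k. fps_nth f i * (fps_nth g (k - i) / real (k - i))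
        + fps_nth f i / real i * fps_nth g (k - i))"
    proof (rule sum.cong)
      fix i
      \<comment> \<open>With \<open>x / 0 = 0\<close> the cancellation
        \<open>a * (x / a) = x\<close> also holds for \<open>a = 0\<close> once
        \<open>x = 0\<close>; the vanishing constant coefficients provide this.\<close>
      have "(a + b) * (x / a * (y / b)) = x * (y / b) + x / a * y"
        if "a = 0 \<Longrightarrow> x = 0" "b = 0 \<Longrightarrow> y = 0" for a b x y :: real
        using that by (cases "a = 0"; cases "b = 0") (simp_all add: field_simps)
      then show "(real i + real (k - i)) * (fps_nth f i / real i *
          (fps_nth g (k - i) / real (k - i)))
        = fps_nth f i * (fps_nth g (k - i) / real (k - i))
            + fps_nth f i / real i * fps_nth g (k - i)"
        using assms by (metis of_nat_eq_0_iff)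
    qed simp
    also have "\<dots> = fps_nth (f * euler_int g + euler_int f * g) k"
      by (simp add: fps_mult_nth sum.distrib)
    finally show ?thesis using False by (simp add: field_simps)
  qed simp
qed

text \<open>The terms of the expansion of \<open>J\<^sup>p\<^sup>+\<^sup>1 u \<cdot> J\<^sup>q\<^sup>+\<^sup>1 v\<close>, where \<open>J\<close> is
  \<open>euler_int\<close>, in which the last integration to be split off belongs to \<open>v\<close>.\<close>

definition half_expansion :: "nat \<Rightarrow> nat \<Rightarrow> real fps \<Rightarrow> real fps \<Rightarrow> real fps"
  where "half_expansion p q u v =
    (\<Sum>r\<le>p. real ((r + q) choose q) *\<^sub>R (euler_int ^^ Suc (r + q))
        (v * (euler_int ^^ Suc (p - r)) u))"

lemma half_expansion_0: "half_expansion 0 q u v = (euler_int ^^ Suc q) (v * euler_int u)"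
  by (simp add: half_expansion_def)

lemma half_expansion_Suc_0:
  "half_expansion (Suc p) 0 u v =
    euler_int (v * (euler_int ^^ Suc (Suc p)) u) + euler_int (half_expansion p 0 u v)"
  unfolding half_expansion_def sum.atMost_Suc_shift by (simp add: euler_int_simps)

text \<open>Pascal's rule splits the coefficients with \<open>r > 0\<close>; the term
  \<open>r = 0\<close>, with coefficient 1, completes the second sum.\<close>

lemma half_expansion_Suc_Suc:
  "half_expansion (Suc p) (Suc q) u v =
    euler_int (half_expansion p (Suc q) u v) + euler_int (half_expansion (Suc p) q u v)"
proof -
  let ?t = "\<lambda>r. (euler_int ^^ Suc (Suc (Suc (r + q)))) (v * (euler_int ^^ Suc (p - r)) u)"
  let ?s = "(euler_int ^^ Suc (Suc q)) (v * (euler_int ^^ Suc (Suc p)) u)"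
  have "half_expansion (Suc p) (Suc q) u v
      = ?s + (\<Sum>r\<le>p. real (Suc (Suc (r + q)) choose Suc q) *\<^sub>R ?t r)"
    unfolding half_expansion_def sum.atMost_Suc_shift by simp
  also have "(\<Sum>r\<le>p. real (Suc (Suc (r + q)) choose Suc q) *\<^sub>R ?t r)
      = (\<Sum>r\<le>p. real (Suc (r + q) choose Suc q) *\<^sub>R ?t r) +
          (\<Sum>r\<le>p. real (Suc (r + q) choose q) *\<^sub>R ?t r)"
    unfolding sum.distrib[symmetric]
    by (rule sum.cong) (simp_all add: scaleR_left_distrib[symmetric] del: funpow.simps)
  also have "(\<Sum>r\<le>p. real (Suc (r + q) choose Suc q) *\<^sub>R ?t r)
      = euler_int (half_expansion p (Suc q) u v)"
    by (simp add: half_expansion_def euler_int_simps)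
  also have "?s + (euler_int (half_expansion p (Suc q) u v) +
      (\<Sum>r\<le>p. real (Suc (r + q) choose q) *\<^sub>R ?t r))
      = euler_int (half_expansion p (Suc q) u v)
          + (?s + (\<Sum>r\<le>p. real (Suc (r + q) choose q) *\<^sub>R ?t r))"
    by (simp only: add_ac)
  also have "?s + (\<Sum>r\<le>p. real (Suc (r + q) choose q) *\<^sub>R ?t r)
      = euler_int (half_expansion (Suc p) q u v)"
    unfolding half_expansion_def sum.atMost_Suc_shift by (simp add: euler_int_simps)
  finally show ?thesis .
qed

text \<open>Both sides satisfy the recursion in \<open>p + q\<close> that one integration by parts
  gives.\<close>

lemma euler_int_funpow_mult:
  assumes u: "fps_nth u 0 = 0" and v: "fps_nth v 0 = 0"
  shows "(euler_int ^^ Suc p) u * (euler_int ^^ Suc q) v = half_expansion p q u v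
      + half_expansion q p v u"
proof (induction "p + q" arbitrary: p q)
  case 0
  then show ?case
    by (simp add: half_expansion_0 euler_int_mult[OF u v] euler_int_simps mult.commute)
next
  case (Suc n)
  have z: "fps_nth ((euler_int ^^ m) u) 0 = 0" "fps_nth ((euler_int ^^ m) v) 0 = 0" for m
    using u v by (simp_all add: euler_int_funpow_nth)
  have step: "(euler_int ^^ Suc p) u * (euler_int ^^ Suc q) v
      = euler_int ((euler_int ^^ p) u * (euler_int ^^ Suc q) v)
        + euler_int ((euler_int ^^ Suc p) u * (euler_int ^^ q) v)"
    using euler_int_mult[OF z(1)[of p] z(2)[of q]] by (simp add: euler_int_simps)
  show ?case
  proof (cases p)
    case 0
    then obtain m where m: "q = Suc m" using Suc.hyps(2) by (cases q) auto
    \<comment> \<open>For \<open>p = 0\<close> the first product in \<open>step\<close> has no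
      integration left on \<open>u\<close>; it is the leading term of
      \<open>half_expansion (Suc m) 0 v u\<close>, and only the second product needs the induction
      hypothesis.\<close>
    have "(euler_int ^^ Suc 0) u * (euler_int ^^ Suc m) v = half_expansion 0 m u v
        + half_expansion m 0 v u"
      by (rule Suc.hyps(1)) (use Suc.hyps(2) 0 m in simp)
    then show ?thesis
      unfolding step unfolding 0 m half_expansion_Suc_0
      by (simp add: half_expansion_0 euler_int_simps)
  next
    case p: (Suc l)
    show ?thesis
    proof (cases q)
      case 0
      have "(euler_int ^^ Suc l) u * (euler_int ^^ Suc 0) v = half_expansion l 0 u v
          + half_expansion 0 l v u"
        by (rule Suc.hyps(1)) (use Suc.hyps(2) 0 p in simp)
      then show ?thesis
        unfolding step unfolding 0 p half_expansion_Suc_0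
        by (simp add: half_expansion_0 euler_int_simps mult.commute)
    next
      case q: (Suc m)
      have "(euler_int ^^ Suc l) u * (euler_int ^^ Suc q) v = half_expansion l q u v
          + half_expansion q l v u"
        by (rule Suc.hyps(1)) (use Suc.hyps(2) q p in simp)
      moreover have "(euler_int ^^ Suc p) u * (euler_int ^^ Suc m) v = half_expansion p m u v
          + half_expansion m p v u"
        by (rule Suc.hyps(1)) (use Suc.hyps(2) q p in simp)
      ultimately show ?thesis
        unfolding step unfolding p q half_expansion_Suc_Suc
        by (simp only: euler_int_simps add_ac)
    qed
  qed
qed

text \<open>The index \<open>i = a - r\<close> counts the integrations left on \<open>u\<close>,
  which brings the coefficients into the form used in \<open>err\<close>.\<close>

lemma half_expansion_alt:
  assumes "a \<ge> 1" "b \<ge> 1"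
  shows "half_expansion (a - 1) (b - 1) u v =
    (\<Sum>i=1..a. real ((a - i + b - 1) choose (b - 1))
        *\<^sub>R (euler_int ^^ (a + b - i)) ((euler_int ^^ i) u * v))"
  unfolding half_expansion_def
proof (rule sum.reindex_bij_witness[of _ "\<lambda>i. a - i" "\<lambda>r. a - r"])
  fix r assume "r \<in> {..a - 1}"
  then have "Suc (r + (b - 1)) = a + b - (a - r)" "r + (b - 1) = a - (a - r) + b - 1"
      "Suc (a - 1 - r) = a - r"
    using assms by auto
  then show "real (a - (a - r) + b - 1 choose (b - 1)) *\<^sub>R
          (euler_int ^^ (a + b - (a - r))) ((euler_int ^^ (a - r)) u * v) =
         real (r + (b - 1) choose (b - 1)) *\<^sub>R
          (euler_int ^^ Suc (r + (b - 1))) (v * (euler_int ^^ Suc (a - 1 - r)) u)"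
    by (simp only: mult.commute)
qed (use assms in auto)

section \<open>Generating series\<close>

text \<open>Densities with respect to \<open>dt/t\<close> of the forms attached to the two
  letters.\<close>

definition letter_kernel :: "letter \<Rightarrow> real fps"
  where "letter_kernel a = (case a of X \<Rightarrow> 1 | Y \<Rightarrow> geom_tail)"

fun Li :: "letter ptree \<Rightarrow> real fps"
  where "Li (Node a ts) = euler_int (letter_kernel a * (\<Prod>t\<leftarrow>ts. Li t))"

lemma Li_nth_0 [simp]: "fps_nth (Li t) 0 = 0"
  by (cases t) simp

text \<open>A vertex \<open>Y\<close> brings the factor \<open>t/(1-t)\<close>, and a vertex
  \<open>X\<close> has a child, whose series has no constant term. This is where leaves must carry
  \<open>Y\<close>.\<close>

lemma Li_integrand_nth_0:
  "Y_branched (Node a ts) \<Longrightarrow> fps_nth (letter_kernel a * (\<Prod>t\<leftarrow>ts. Li t)) 0 = 0"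
  by (cases a; cases ts) (auto simp: letter_kernel_def)

lemma lin_ext_Li_graft_at:
  "lin_ext Li (graft_at a F v G)
    = euler_int (letter_kernel a * ((\<Prod>t\<leftarrow>F. Li t) * (lin_ext Li v * (\<Prod>t\<leftarrow>G. Li t))))"
proof -
  have "linear (\<lambda>f. euler_int (letter_kernel a * ((\<Prod>t\<leftarrow>F. Li t) * (f * (\<Prod>t\<leftarrow>G. Li t)))))"
    by (rule linearI)
      (simp_all add: euler_int_simps distrib_left distrib_right fps_mult_scaleR_left
          fps_mult_scaleR_right)
  from linear_lin_ext_apply[OF this, of Li v] show ?thesis
    by (simp add: lin_ext_graft_at)
qed

lemma lin_ext_Li_sh_left:
  assumes "Ss \<noteq> [] \<Longrightarrow> lin_ext Li (sh_tree (last Ss) T) = Li (last Ss) * Li T"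
  shows "lin_ext Li (sh_left (Node a Ss) T) = euler_int (letter_kernel a * (\<Prod>t\<leftarrow>Ss. Li t) * Li T)"
proof (cases Ss rule: rev_cases)
  case (snoc us u)
  then show ?thesis
    using assms by (simp add: lin_ext_Li_graft_at mult_ac del: sh_tree.simps Li.simps)
qed simp

lemma lin_ext_Li_sh_right:
  assumes "Ts \<noteq> [] \<Longrightarrow> lin_ext Li (sh_tree S (hd Ts)) = Li S * Li (hd Ts)"
  shows "lin_ext Li (sh_right S (Node b Ts)) = euler_int (Li S * (letter_kernel b * (\<Prod>t\<leftarrow>Ts. Li t)))"
proof (cases Ts)
  case (Cons u us)
  then show ?thesis
    using assms by (simp add: lin_ext_Li_graft_at mult_ac del: sh_tree.simps Li.simps)
qed (simp add: mult.commute)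

text \<open>The left and right products correspond to the two summands of integration by parts
  applied to the root integrations of \<open>S\<close> and \<open>T\<close>.\<close>

lemma lin_ext_Li_sh_tree:
  "Y_branched S \<Longrightarrow> Y_branched T \<Longrightarrow> lin_ext Li (sh_tree S T) = Li S * Li T"
proof (induction "size S + size T" arbitrary: S T rule: less_induct)
  case less
  obtain a Ss where S: "S = Node a Ss" by (cases S)
  obtain b Ts where T: "T = Node b Ts" by (cases T)
  have "lin_ext Li (sh_tree (last Ss) T) = Li (last Ss) * Li T" if "Ss \<noteq> []"
    using that less.prems size_hd_last_less[of Ss] by (intro less.hyps) (auto simp: S)
  note l = lin_ext_Li_sh_left[OF this]
  have "lin_ext Li (sh_tree S (hd Ts)) = Li S * Li (hd Ts)" if "Ts \<noteq> []"
    using that less.prems size_hd_last_less[of Ts] by (intro less.hyps) (auto simp: T)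
  note r = lin_ext_Li_sh_right[OF this]
  have "lin_ext Li (sh_tree S T)
    = euler_int (letter_kernel a * (\<Prod>t\<leftarrow>Ss. Li t) * Li T + Li S * (letter_kernel b * (\<Prod>t\<leftarrow>Ts. Li t)))"
    using l r unfolding S T by (simp add: euler_int_simps del: Li.simps)
  also have "\<dots> = Li S * Li T"
    using euler_int_mult[OF Li_integrand_nth_0[of a Ss] Li_integrand_nth_0[of b Ts]] less.prems
    unfolding S T by (simp only: Li.simps add.commute)
  finally show ?case .
qed

lemma Li_funpow_X: "Li (((\<lambda>t. Node X [t]) ^^ m) s) = (euler_int ^^ m) (Li s)"
  by (induction m) (simp_all add: letter_kernel_def)

lemma Li_sPN_tree:
  "n \<ge> 1 \<Longrightarrow> Li (sPN_tree (Node n ts)) = (euler_int ^^ n) (geom_tail * (\<Prod>t\<leftarrow>ts. Li (sPN_tree t)))"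
  by (cases n) (simp_all add: Li_funpow_X letter_kernel_def comp_def funpow_swap1)

text \<open>The effect of the trunk on the product of the series of the crown. Its linearity
  transports identities between crowns to whole trees.\<close>

fun graft_int :: "nat list \<Rightarrow> real fps \<Rightarrow> real fps"
  where
    "graft_int [] f = f"
  | "graft_int (n # ns) f = (euler_int ^^ n) (geom_tail * graft_int ns f)"

lemma linear_graft_int: "linear (graft_int ns)"
proof (induction ns)
  case (Cons n ns)
  have "linear ((euler_int ^^ n) \<circ> ((\<lambda>f. geom_tail * f) \<circ> graft_int ns))"
    by (intro linear_compose linear_euler_int_funpow linear_fps_mult Cons)
  then show ?case by (simp add: comp_def)
qed (simp add: linear_iff)

lemma Li_sPN_graft_trunk:
  "ns \<noteq> [] \<Longrightarrow> set ns \<subseteq> pos_nats \<Longrightarrow>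
    Li (sPN_tree (graft_trunk ns F)) = graft_int ns (\<Prod>t\<leftarrow>F. Li (sPN_tree t))"
  by (induction ns F rule: graft_trunk.induct)
      (simp_all add: Li_sPN_tree pos_nats_def del: sPN_tree.simps)

text \<open>The coefficient at \<open>k\<close> is the part of the zeta series with root value
  \<open>k\<close>. It is 0 at \<open>k = 0\<close>, so sums over \<open>j<k\<close> effectively run
  over positive integers.\<close>

fun zeta_ps :: "nat ptree \<Rightarrow> real fps"
  where "zeta_ps (Node n ts) =
    Abs_fps (\<lambda>k. if k = 0 then 0 else (\<Prod>t\<leftarrow>ts. \<Sum>j<k. fps_nth (zeta_ps t) j) / real k ^ n)"

lemma zeta_ps_nth_0 [simp]: "fps_nth (zeta_ps t) 0 = 0"
  by (cases t) simp

lemma zeta_ps_graft: "n \<ge> 1 \<Longrightarrow> zeta_ps (Node n [t]) = (euler_int ^^ n) (geom_tail * zeta_ps t)"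
  by (rule fps_ext) (simp add: euler_int_funpow_nth geom_tail_mult_nth)

lemma zeta_ps_graft_add: "zeta_ps t = zeta_ps u + zeta_ps v + zeta_ps w \<Longrightarrow> zeta_ps (Node n [t])
    = zeta_ps (Node n [u]) + zeta_ps (Node n [v]) + zeta_ps (Node n [w])"
  by (rule fps_ext) (simp add: add_divide_distrib sum.distrib)

text \<open>Pairs of root values below \<open>k\<close> are sorted into equal ones, those with the
  first larger, and those with the second larger; the larger value belongs to the vertex nearer the
  root.\<close>

lemma truncated_zeta_ps_mult:
  "(\<Sum>j<k. fps_nth (zeta_ps (Node na Fa)) j) * (\<Sum>j<k. fps_nth (zeta_ps (Node nb Fb)) j) =
    (\<Sum>j<k. fps_nth (zeta_ps (Node (na + nb) (Fa @ Fb))) j) +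
        (\<Sum>j<k. fps_nth (zeta_ps (Node na (Node nb Fb # Fa))) j)
    + (\<Sum>j<k. fps_nth (zeta_ps (Node nb (Node na Fa # Fb))) j)"
proof (induction k)
  case (Suc k)
  let ?a = "fps_nth (zeta_ps (Node na Fa)) k" and ?b = "fps_nth (zeta_ps (Node nb Fb)) k"
  let ?A = "\<Sum>j<k. fps_nth (zeta_ps (Node na Fa)) j" and ?B =
      "\<Sum>j<k. fps_nth (zeta_ps (Node nb Fb)) j"
  \<comment> \<open>The last three terms are the increment of the product, one for each of the three
    trees.\<close>
  have "(?A + ?a) * (?B + ?b) = ?A * ?B + ?a * ?b + ?a * ?B + ?A * ?b"
    by (simp add: algebra_simps)
  moreover have "?a * ?b = fps_nth (zeta_ps (Node (na + nb) (Fa @ Fb))) k"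
    by (simp add: power_add)
  moreover have "?a * ?B = fps_nth (zeta_ps (Node na (Node nb Fb # Fa))) k"
    "?A * ?b = fps_nth (zeta_ps (Node nb (Node na Fa # Fb))) k"
    by (cases "k = 0", simp, subst zeta_ps.simps, subst (2) zeta_ps.simps, simp del: zeta_ps.simps)+
  ultimately show ?case
    unfolding sum.lessThan_Suc Suc.IH[symmetric] by (simp only: Suc.IH add_ac)
qed simp

lemma zeta_ps_graft_trunk_flatten:
  "ns \<noteq> [] \<Longrightarrow> zeta_ps (graft_trunk ns (Node na Fa # Node nb Fb # F)) =
    zeta_ps (graft_trunk ns (Node (na + nb) (Fa @ Fb) # F))
    + zeta_ps (graft_trunk ns (Node na (Node nb Fb # Fa) # F))
    + zeta_ps (graft_trunk ns (Node nb (Node na Fa # Fb) # F))"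
proof (induction ns rule: induct_list012)
  case (2 n)
  have "zeta_ps (Node n (Node na Fa # Node nb Fb # F)) =
    zeta_ps (Node n (Node (na + nb) (Fa @ Fb) # F))
        + zeta_ps (Node n (Node na (Node nb Fb # Fa) # F))
    + zeta_ps (Node n (Node nb (Node na Fa # Fb) # F))"
    unfolding zeta_ps.simps[of n]
    by (rule fps_ext) (simp add: truncated_zeta_ps_mult distrib_right add_divide_distrib flip:
        mult.assoc
        del: zeta_ps.simps)
  then show ?case by simp
next
  case (3 n m ns)
  then show ?case unfolding graft_trunk.simps by (intro zeta_ps_graft_add) simp
qed simp

lemma zeta_ps_flatten: "\<not> ladder T \<Longrightarrow> zeta_ps T = zeta_ps (T_sum T) + zeta_ps (T_ab T)
    + zeta_ps (T_ba T)"
  by (erule non_ladder_graft_trunk) (simp add: T_sum_def T_ab_def T_ba_def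
      zeta_ps_graft_trunk_flatten del: zeta_ps.simps)

text \<open>Without branching no products occur, and both series arise by repeatedly applying
  \<open>euler_int ^^ n\<close> after multiplication by \<open>geom_tail\<close>.\<close>

lemma Li_sPN_ladder: "T \<in> PT pos_nats \<Longrightarrow> ladder T \<Longrightarrow> Li (sPN_tree T) = zeta_ps T"
proof (induction T)
  case (Node n ts)
  have n: "n \<ge> 1" using Node.prems by (auto simp: PT_def pos_nats_def)
  show ?case
  proof (cases ts)
    case Nil
    then show ?thesis
      by (simp add: Li_sPN_tree[OF n] fps_eq_iff euler_int_funpow_nth geom_tail_def
          del: sPN_tree.simps)
  next
    case (Cons t us)
    then have ts: "ts = [t]" using Node.prems by simp
    then have "Li (sPN_tree t) = zeta_ps t" using Node by (auto simp: PT_def)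
    then show ?thesis
      unfolding ts Li_sPN_tree[OF n] zeta_ps_graft[OF n] by simp
  qed
qed

lemma Li_sPN_mult:
  assumes "na \<ge> 1" "nb \<ge> 1"
  shows "Li (sPN_tree (Node na Fa)) * Li (sPN_tree (Node nb Fb)) =
      Li (sPN_tree (Node na (Node nb Fb # Fa))) + Li (sPN_tree (Node nb (Node na Fa # Fb)))
    + (\<Sum>i=1..na-1. real ((na - i + nb - 1) choose (nb - 1))
        *\<^sub>R Li (sPN_tree (Node (na + nb - i) (Node i Fa # Fb))))
    + (\<Sum>i=1..nb-1. real ((nb - i + na - 1) choose (na - 1))
        *\<^sub>R Li (sPN_tree (Node (na + nb - i) (Node i Fb # Fa))))"
proof -
  have half: "half_expansion (a - 1) (b - 1) (geom_tail * (\<Prod>t\<leftarrow>F. Li (sPN_tree t)))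
      (geom_tail * (\<Prod>t\<leftarrow>G. Li (sPN_tree t)))
      = Li (sPN_tree (Node b (Node a F # G)))
       + (\<Sum>i=1..a-1. real ((a - i + b - 1) choose (b - 1))
           *\<^sub>R Li (sPN_tree (Node (a + b - i) (Node i F # G))))"
    if ab: "a \<ge> 1" "b \<ge> 1" for a b F G
  proof -
    have *: "(euler_int ^^ (a + b - i)) ((euler_int ^^ i) (geom_tail * (\<Prod>t\<leftarrow>F. Li (sPN_tree t))) *
        (geom_tail * (\<Prod>t\<leftarrow>G. Li (sPN_tree t))))
      = Li (sPN_tree (Node (a + b - i) (Node i F # G)))" if "i \<in> {1..a}" for i
    proof -
      have "a + b - i \<ge> 1" "i \<ge> 1" using that ab by auto
      then show ?thesis
        unfolding prod_list.Cons list.map by (simp only: Li_sPN_tree prod_list.Cons list.map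
            mult_ac)
    qed
    have "half_expansion (a - 1) (b - 1) (geom_tail * (\<Prod>t\<leftarrow>F. Li (sPN_tree t)))
        (geom_tail * (\<Prod>t\<leftarrow>G. Li (sPN_tree t)))
      = (\<Sum>i=1..a. real ((a - i + b - 1) choose (b - 1))
          *\<^sub>R Li (sPN_tree (Node (a + b - i) (Node i F # G))))"
      unfolding half_expansion_alt[OF ab] by (rule sum.cong) (simp_all only: *)
    \<comment> \<open>The term \<open>i = a\<close> has coefficient 1 and is the stacked tree; the
      remaining range is the one in the error term.\<close>
    also have "{1..a} = insert a {1..a - 1}"
      using ab by auto
    finally show ?thesis
      using ab by (simp del: sPN_tree.simps)
  qed
  have "Li (sPN_tree (Node na Fa)) * Li (sPN_tree (Node nb Fb))
    = half_expansion (na - 1) (nb - 1) (geom_tail * (\<Prod>t\<leftarrow>Fa. Li (sPN_tree t)))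
        (geom_tail * (\<Prod>t\<leftarrow>Fb. Li (sPN_tree t)))
    + half_expansion (nb - 1) (na - 1) (geom_tail * (\<Prod>t\<leftarrow>Fb. Li (sPN_tree t)))
        (geom_tail * (\<Prod>t\<leftarrow>Fa. Li (sPN_tree t)))"
    using euler_int_funpow_mult[of "geom_tail * (\<Prod>t\<leftarrow>Fa. Li (sPN_tree t))"
        "geom_tail * (\<Prod>t\<leftarrow>Fb. Li (sPN_tree t))" "na - 1" "nb - 1"] assms
    by (simp add: Li_sPN_tree del: sPN_tree.simps funpow.simps)
  then show ?thesis
    unfolding half[OF assms] half[OF assms(2,1)] by (simp add: add.commute[of nb na] add_ac)
qed

text \<open>The error term removes the extra trees of the iterated-integral product and adds
  \<open>T_sum T\<close>, leaving the three trees that also appear in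
  \<open>zeta_ps_flatten\<close>.\<close>

lemma Li_sPN_flatten:
  assumes "T \<in> PT pos_nats" "\<not> ladder T"
  shows "Li (sPN_tree T) + lin_ext (\<lambda>t. Li (sPN_tree t)) (err T)
    = Li (sPN_tree (T_sum T)) + Li (sPN_tree (T_ab T)) + Li (sPN_tree (T_ba T))"
proof -
  obtain ns na Fa nb Fb F where c: "ns \<noteq> []" "T = graft_trunk ns (Node na Fa # Node nb Fb # F)"
    "trunk T = ns" "crown T = Node na Fa # Node nb Fb # F"
    using non_ladder_graft_trunk[OF assms(2)] .
  let ?P = "\<Prod>t\<leftarrow>F. Li (sPN_tree t)"
  let ?I = "\<lambda>t. graft_int ns (Li (sPN_tree t) * ?P)"
  have pos: "set ns \<subseteq> pos_nats" "na \<ge> 1" "nb \<ge> 1"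
    using assms(1) unfolding c(2) by (auto simp: PT_def set_graft_trunk[OF c(1)] pos_nats_def)
  have I: "Li (sPN_tree (graft_trunk ns (t # F))) = ?I t" for t
    using Li_sPN_graft_trunk[OF c(1) pos(1)] by simp
  have lin: "linear (\<lambda>f. graft_int ns (f * ?P))"
    by (rule linearI) (simp_all add: distrib_right fps_mult_scaleR_left
        linear_add[OF linear_graft_int]
        linear_scale[OF linear_graft_int])
  have "Li (sPN_tree T) = graft_int ns (Li (sPN_tree (Node na Fa)) * Li (sPN_tree (Node nb Fb)) *
      ?P)"
    unfolding c(2) using Li_sPN_graft_trunk[OF c(1) pos(1)] by
        (simp add: mult.assoc del: sPN_tree.simps)
  also have "\<dots> = ?I (Node na (Node nb Fb # Fa)) + ?I (Node nb (Node na Fa # Fb))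
    + (\<Sum>i=1..na-1. real ((na - i + nb - 1) choose (nb - 1))
        *\<^sub>R ?I (Node (na + nb - i) (Node i Fa # Fb)))
    + (\<Sum>i=1..nb-1. real ((nb - i + na - 1) choose (na - 1))
        *\<^sub>R ?I (Node (na + nb - i) (Node i Fb # Fa)))"
    unfolding Li_sPN_mult[OF pos(2,3)] by (simp only: linear_add[OF lin] linear_sum[OF lin]
        linear_scale[OF lin])
  finally show ?thesis
    by (simp add: err_def T_sum_def T_ab_def T_ba_def c(3,4) lin_ext_sum I del: sPN_tree.simps)
qed

lemma lin_ext_Li_sPT_basis: "lin_ext Li (sPT (basis_vec T))
    = lin_ext (\<lambda>t. Li (sPN_tree t)) (phi_tree T)"
  by (simp add: sPT_def sPN_def phi_def linear_lin_ext_apply[OF linear_lin_ext])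

text \<open>By \<open>Li_sPN_flatten\<close> the terms other than the three \<open>phi_tree\<close>
  terms cancel in the recursion of \<open>phi_tree\<close>, so both sides are additive along the
  process and agree on ladder trees.\<close>

lemma lin_ext_Li_phi_tree: "T \<in> PT pos_nats \<Longrightarrow> lin_ext (\<lambda>t. Li (sPN_tree t)) (phi_tree T)
    = zeta_ps T"
proof (induction T rule: process.induct)
  case (1 T)
  show ?case
  proof (cases "ladder T")
    case True
    then show ?thesis using 1(4) by (simp add: phi_tree_ladder Li_sPN_ladder)
  next
    case False
    have "s \<in> PT pos_nats" if "s \<in> below T" for s
      using that by (simp add: below_def)
    then have "lin_ext (\<lambda>t. Li (sPN_tree t)) (phi_tree s) = zeta_ps s" if
        "s \<in> {T_sum T, T_ab T, T_ba T}" for s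
      using that 1(1-3)[OF False] T_children_below[OF 1(4) False] by auto
    then show ?thesis
      using Li_sPN_flatten[OF 1(4) False] zeta_ps_flatten[OF False]
      by (simp add: phi_tree_rec[OF False] algebra_simps)
  qed
qed

section \<open>Arborified zeta values as sums over the value at the root\<close>

definition zeta_slice :: "'a ptree \<Rightarrow> nat \<Rightarrow> (nat list \<Rightarrow> nat) set"
  where "zeta_slice t k = {f \<in> zeta_index t. f [] = k}"

lemma Nil_in_verts [simp]: "[] \<in> verts t"
  by (cases t) simp

lemma zeta_index_le_root:
  assumes "f \<in> zeta_index t" "p \<in> verts t"
  shows "f p \<le> f []"
proof (cases "p = []")
  case False
  then have "strict_prefix [] p" by (simp add: strict_prefix_def)
  with assms show ?thesis unfolding zeta_index_def by force
qed simp

lemma Cons_in_verts_iff [simp]: "i # p \<in> verts (Node a ts) \<longleftrightarrow> i < length ts \<and> p \<in> verts (ts ! i)"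
  by auto

text \<open>Two comparable vertices either lie in one child subtree or include the root. Since a
  subtree has its largest value at its own root, only the children need comparing with
  \<open>k\<close>.\<close>

lemma zeta_slice_Node:
  "f \<in> zeta_slice (Node a ts) k \<longleftrightarrow> f \<in> extensional (verts (Node a ts)) \<and> f [] = k \<and> k \<ge> 1 \<and>
    (\<forall>i<length ts. restrict (\<lambda>p. f (i # p)) (verts (ts ! i)) \<in> {g \<in> zeta_index (ts ! i). g [] < k})"
  (is "?L \<longleftrightarrow> ?R")
proof
  assume L: ?L
  then have f: "f \<in> verts (Node a ts) \<rightarrow>\<^sub>E pos_nats" "f [] = k"
    by (simp_all add: zeta_slice_def zeta_index_def del: verts.simps)
  have lt: "f v < f u" if "u \<in> verts (Node a ts)" "v \<in> verts (Node a ts)" "strict_prefix u v"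
      for u v
    using L that by (simp add: zeta_slice_def zeta_index_def del: verts.simps)
  show ?R
  proof (intro conjI allI impI)
    show "f \<in> extensional (verts (Node a ts))" using f(1) by (simp add: PiE_iff del: verts.simps)
    show "f [] = k" by fact
    show "k \<ge> 1" using PiE_mem[OF f(1), of "[]"] f(2) by (simp add: pos_nats_def)
    fix i assume i: "i < length ts"
    have "f (i # p) \<in> pos_nats" if "p \<in> verts (ts ! i)" for p
      using PiE_mem[OF f(1), of "i # p"] i that by (simp del: verts.simps)
    moreover have "f (i # q) < f (i # p)"
      if "p \<in> verts (ts ! i)" "q \<in> verts (ts ! i)" "strict_prefix p q" for p q
      using lt[of "i # p" "i # q"] i that by (simp del: verts.simps)
    moreover have "f [i] < k"
      using lt[of "[]" "[i]"] i f(2) by (simp add: strict_prefix_def del: verts.simps)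
    ultimately show "restrict (\<lambda>p. f (i # p)) (verts (ts ! i)) \<in> {g
        \<in> zeta_index (ts ! i). g [] < k}"
      by (simp add: zeta_index_def)
  qed
next
  assume R: ?R
  have sub: "restrict (\<lambda>p. f (i # p)) (verts (ts ! i)) \<in> zeta_index (ts ! i)" "f [i] < k"
    if "i < length ts" for i using R that by (auto dest!: spec[of _ i])
  have pos: "f (i # p) \<in> pos_nats" if "i < length ts" "p \<in> verts (ts ! i)" for i p
    using sub(1)[OF that(1)] that(2) by (auto simp: zeta_index_def)
  have lt_root: "f (i # p) < k" if "i < length ts" "p \<in> verts (ts ! i)" for i p
    using zeta_index_le_root[OF sub(1)[OF that(1)] that(2)] sub(2)[OF that(1)] that(2) by simp
  have lt: "f (i # q) < f (i # p)"
    if "i < length ts" "p \<in> verts (ts ! i)" "q \<in> verts (ts ! i)" "strict_prefix p q" for i p q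
    using sub(1)[OF that(1)] that(2-) by (auto simp: zeta_index_def)
  have "f v \<in> pos_nats" if "v \<in> verts (Node a ts)" for v
    using that R pos by (cases v) (auto simp: pos_nats_def)
  moreover have "f v < f u" if "u \<in> verts (Node a ts)" "v \<in> verts (Node a ts)" "strict_prefix u v"
      for u v
    using that R lt lt_root by (cases u; cases v) (auto simp del: verts.simps)
  ultimately show ?L
    using R by (auto simp: zeta_slice_def zeta_index_def PiE_iff simp del: verts.simps)
qed

definition zeta_summand :: "nat ptree \<Rightarrow> (nat list \<Rightarrow> nat) \<Rightarrow> real"
  where "zeta_summand t f = (\<Prod>v\<in>verts t. 1 / real (f v) ^ deco t v)"

lemma zeta_summand_restrict: "zeta_summand t (restrict f (verts t)) = zeta_summand t f"
  by (simp add: zeta_summand_def)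

lemma zeta_summand_Node:
  "zeta_summand (Node n ts) f = (\<Prod>i<length ts. zeta_summand (ts ! i) (\<lambda>p. f (i # p))) / real
      (f []) ^ n"
proof -
  have "zeta_summand (Node n ts) f
      = 1 / real (f []) ^ n * (\<Prod>v\<in>(\<Union>i<length ts. (#) i ` verts (ts ! i)). 1 / real (f v) ^ deco
          (Node n ts) v)"
    unfolding zeta_summand_def verts_children by (subst prod.insert) (auto simp: finite_verts)
  also have "(\<Prod>v\<in>(\<Union>i<length ts. (#) i ` verts (ts ! i)). 1 / real (f v) ^ deco (Node n ts) v)
      = (\<Prod>i<length ts. \<Prod>v\<in>(#) i ` verts (ts ! i). 1 / real (f v) ^ deco (Node n ts) v)"
    by (rule prod.UNION_disjoint) (auto simp: finite_verts)
  also have "\<dots> = (\<Prod>i<length ts. zeta_summand (ts ! i) (\<lambda>p. f (i # p)))"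
    unfolding zeta_summand_def by (rule prod.cong) (simp_all add: prod.reindex)
  finally show ?thesis by simp
qed

lemma zeta_slice_0: "zeta_slice t 0 = {}"
proof -
  have "f [] \<in> pos_nats" if "f \<in> zeta_index t" for f
    using that Nil_in_verts unfolding zeta_index_def by blast
  then show ?thesis by (force simp: zeta_slice_def pos_nats_def)
qed

lemma zeta_below_root: "{f \<in> zeta_index t. f [] < k} = (\<Union>j<k. zeta_slice t j)"
  by (auto simp: zeta_slice_def)

text \<open>A slice becomes a product set over the children, so that sums over it factor.\<close>

lemma zeta_slice_bij:
  "bij_betw (\<lambda>f. \<lambda>i\<in>{..<length ts}. restrict (\<lambda>p. f (i # p)) (verts (ts ! i)))
    (zeta_slice (Node a ts) (Suc k)) (\<Pi>\<^sub>E i\<in>{..<length ts}. {g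
        \<in> zeta_index (ts ! i). g [] < Suc k})"
\<comment> \<open>The inverse glues the child functions under the root value;
  \<open>undefined\<close> at other addresses keeps the result extensional.\<close>
proof (rule bij_betwI[where g = "\<lambda>h v. case v of [] \<Rightarrow> Suc k | i # p \<Rightarrow>
    if i < length ts then h i p else undefined"])
  show "(\<lambda>f. \<lambda>i\<in>{..<length ts}. restrict (\<lambda>p. f (i # p)) (verts (ts ! i))) \<in>
      zeta_slice (Node a ts) (Suc k) \<rightarrow> (\<Pi>\<^sub>E i\<in>{..<length ts}. {g
          \<in> zeta_index (ts ! i). g [] < Suc k})"
  proof
    fix f assume "f \<in> zeta_slice (Node a ts) (Suc k)"
    then show "(\<lambda>i\<in>{..<length ts}. restrict (\<lambda>p. f (i # p)) (verts (ts ! i)))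
        \<in> (\<Pi>\<^sub>E i\<in>{..<length ts}. {g \<in> zeta_index (ts ! i). g [] < Suc k})"
      unfolding zeta_slice_Node by simp
  qed
  have ext: "h i p = undefined"
    if "h \<in> (\<Pi>\<^sub>E i\<in>{..<length ts}. {g \<in> zeta_index (ts ! i). g [] < Suc k})" "i < length ts"
        "p \<notin> verts (ts ! i)" for h i p
    using that by (auto simp: zeta_index_def PiE_iff extensional_def)
  have res: "restrict (h i) (verts (ts ! i)) = h i"
    if "h \<in> (\<Pi>\<^sub>E i\<in>{..<length ts}. {g \<in> zeta_index (ts ! i). g [] < Suc k})" "i < length ts" for h i
    using ext[OF that] by (auto simp: restrict_def)
  show "(\<lambda>h v. case v of [] \<Rightarrow> Suc k | i # p \<Rightarrow> if i < length ts then h i p else undefined)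
      \<in> (\<Pi>\<^sub>E i\<in>{..<length ts}. {g \<in> zeta_index (ts ! i). g [] < Suc k}) \<rightarrow> zeta_slice (Node a ts)
          (Suc k)"
  proof
    fix h assume h: "h \<in> (\<Pi>\<^sub>E i\<in>{..<length ts}. {g \<in> zeta_index (ts ! i). g [] < Suc k})"
    show "(\<lambda>v. case v of [] \<Rightarrow> Suc k | i # p \<Rightarrow> if i < length ts then h i p else undefined)
        \<in> zeta_slice (Node a ts) (Suc k)"
      unfolding zeta_slice_Node
      using ext[OF h] res[OF h] PiE_mem[OF h] by
          (auto simp: extensional_def restrict_def simp del: verts.simps split: list.split)
  qed
  fix f assume "f \<in> zeta_slice (Node a ts) (Suc k)"
  then show "(\<lambda>v. case v of [] \<Rightarrow> Suc k | i # p \<Rightarrow> if i < length ts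
      then (\<lambda>i\<in>{..<length ts}. restrict (\<lambda>p. f (i # p)) (verts (ts ! i))) i p else undefined) = f"
    unfolding zeta_slice_Node by (auto simp: fun_eq_iff extensional_def simp
        del: verts.simps split: list.split)
next
  fix h assume h: "h \<in> (\<Pi>\<^sub>E i\<in>{..<length ts}. {g \<in> zeta_index (ts ! i). g [] < Suc k})"
  then show "(\<lambda>i\<in>{..<length ts}. restrict (\<lambda>p. (\<lambda>v. case v of [] \<Rightarrow> Suc k
        | i # p \<Rightarrow> if i < length ts then h i p else undefined) (i # p)) (verts (ts ! i))) = h"
    by (auto simp: fun_eq_iff restrict_def zeta_index_def PiE_iff extensional_def)
qed

lemma finite_zeta_slice: "finite (zeta_slice t k)"
proof (induction t arbitrary: k)
  case (Node a ts)
  show ?case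
  proof (cases k)
    case (Suc m)
    have "finite (\<Pi>\<^sub>E i\<in>{..<length ts}. {g \<in> zeta_index (ts ! i). g [] < Suc m})"
      using Node.IH by (intro finite_PiE) (auto simp: zeta_below_root)
    then show ?thesis
      unfolding Suc bij_betw_finite[OF zeta_slice_bij] .
  qed (simp add: zeta_slice_0)
qed

lemma sum_zeta_slice: "(\<Sum>f\<in>zeta_slice t k. zeta_summand t f) = fps_nth (zeta_ps t) k"
proof (induction t arbitrary: k)
  case (Node n ts)
  show ?case
  proof (cases k)
    case k: (Suc m)
    let ?S = "\<lambda>i. {g \<in> zeta_index (ts ! i). g [] < Suc m}"
    have fin: "finite (?S i)" for i
      by (simp add: zeta_below_root finite_zeta_slice)
    have inner: "(\<Sum>g\<in>?S i. zeta_summand (ts ! i) g) = (\<Sum>j<Suc m. fps_nth (zeta_ps (ts ! i)) j)"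
      if "i < length ts" for i
    proof -
      have "(\<Sum>g\<in>?S i. zeta_summand (ts ! i) g) =
          (\<Sum>j<Suc m. \<Sum>g\<in>zeta_slice (ts ! i) j. zeta_summand (ts ! i) g)"
        unfolding zeta_below_root
        by (rule sum.UNION_disjoint) (auto simp: finite_zeta_slice, auto simp: zeta_slice_def)
      then show ?thesis using Node.IH[of "ts ! i"] that by simp
    qed
    have "(\<Sum>f\<in>zeta_slice (Node n ts) k. zeta_summand (Node n ts) f)
      = (\<Sum>f\<in>zeta_slice (Node n ts) (Suc m). (\<Prod>i<length ts. zeta_summand (ts ! i)
          ((\<lambda>i\<in>{..<length ts}. restrict (\<lambda>p. f (i # p)) (verts (ts ! i))) i)) / real (Suc m) ^ n)"
      unfolding k by (rule sum.cong) (simp_all add: zeta_summand_Node zeta_summand_restrict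
          zeta_slice_def)
    also have "\<dots> = (\<Sum>h\<in>(\<Pi>\<^sub>E i\<in>{..<length ts}. ?S i).
        (\<Prod>i<length ts. zeta_summand (ts ! i) (h i)) / real (Suc m) ^ n)"
      by (rule sum.reindex_bij_betw[OF zeta_slice_bij])
    also have "\<dots> = (\<Prod>i<length ts. \<Sum>g\<in>?S i. zeta_summand (ts ! i) g) / real (Suc m) ^ n"
      by (subst prod_sum_PiE) (simp_all add: fin sum_divide_distrib)
    also have "\<dots> = (\<Prod>i<length ts. \<Sum>j<Suc m. fps_nth (zeta_ps (ts ! i)) j) / real (Suc m) ^ n"
      using inner by simp
    also have "\<dots> = fps_nth (zeta_ps (Node n ts)) k"
      by (simp add: k prod.list_conv_set_nth atLeast0LessThan)
    finally show ?thesis .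
  qed (simp add: zeta_slice_0)
qed

lemma zeta_ps_nonneg: "fps_nth (zeta_ps t) k \<ge> 0"
  unfolding sum_zeta_slice[symmetric] zeta_summand_def by (intro sum_nonneg prod_nonneg) simp

text \<open>All summands are nonnegative, so the unordered sum may be grouped into the finite slices
  of fixed root value.\<close>

lemma zeta_tree_eqI:
  assumes "(\<lambda>k. fps_nth (zeta_ps t) k) sums s"
  shows "zeta_tree t = s"
proof -
  have nn: "zeta_summand t f \<ge> 0" for f
    unfolding zeta_summand_def by (intro prod_nonneg) simp
  have zeta_ps: "((\<lambda>k. fps_nth (zeta_ps t) k) has_sum s) UNIV"
    using assms zeta_ps_nonneg by (rule sums_nonneg_imp_has_sum)
  have slice: "((\<lambda>f. zeta_summand t (snd (k, f))) has_sum fps_nth (zeta_ps t) k) (zeta_slice t k)"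
      for k
    using sum_zeta_slice[of t k] by (simp add: has_sum_finiteI finite_zeta_slice)
  have "((\<lambda>kf. zeta_summand t (snd kf)) has_sum s) (Sigma UNIV (zeta_slice t))"
  proof (rule has_sum_SigmaI[OF slice zeta_ps])
    show "(\<lambda>kf. zeta_summand t (snd kf)) summable_on Sigma UNIV (zeta_slice t)"
      using slice zeta_ps nn by (intro summable_on_SigmaI) (auto simp: summable_on_def)
  qed
  moreover have "bij_betw snd (Sigma UNIV (zeta_slice t)) (zeta_index t)"
    by (rule bij_betw_byWitness[where f' = "\<lambda>f. (f [], f)"]) (auto simp: zeta_slice_def)
  ultimately have "(zeta_summand t has_sum s) (zeta_index t)"
    using has_sum_reindex_bij_betw[of snd "Sigma UNIV (zeta_slice t)" "zeta_index t"
        "zeta_summand t" s]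
    by simp
  then have "infsum (zeta_summand t) (zeta_index t) = s"
    by (rule infsumI)
  then show ?thesis
    by (simp add: zeta_tree_def zeta_summand_def[abs_def])
qed

section \<open>Harmonic sums and the quasi-shuffle product\<close>

lemma harm_le: "harm (Suc n) \<le> 1 + ln (real (Suc n))"
  using decseqD[OF decseq_harm_diff_ln, of 0 n] by (simp add: harm_def)

lemma summable_harm_power: "summable (\<lambda>k. harm k ^ m / real k ^ 2)"
proof (rule summable_comparison_test_bigo)
  \<comment> \<open>Any exponent strictly between -2 and -1 is summable and still dominates the
    powers of the logarithm.\<close>
  show "summable (\<lambda>k. norm (real k powr (-3/2)))"
    by (simp add: summable_real_powr_iff)
  have "(\<lambda>k. harm k ^ m / real k ^ 2) \<in> O(\<lambda>k. (1 + ln (real k)) ^ m / real k ^ 2)"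
  proof (rule bigoI[of _ 1], rule eventually_mono[OF eventually_gt_at_top[of 0]])
    fix k :: nat assume "k > 0"
    then obtain n where "k = Suc n" by (cases k) auto
    then have "harm k ^ m \<le> (1 + ln (real k)) ^ m"
      using harm_le[of n] by (intro power_mono) (auto intro: harm_nonneg)
    then show "norm (harm k ^ m / real k ^ 2) \<le> 1 * norm ((1 + ln (real k)) ^ m / real k ^ 2)"
      using \<open>k > 0\<close> by (auto intro!: divide_right_mono simp: harm_nonneg)
  qed
  also have "(\<lambda>k. (1 + ln (real k)) ^ m / real k ^ 2) \<in> O(\<lambda>k. real k powr (-3/2))"
    by real_asymp
  finally show "(\<lambda>k. harm k ^ m / real k ^ 2) \<in> O(\<lambda>k. real k powr (-3/2))" .
qed

text \<open>Passing from \<open>j\<close> to \<open>Suc j\<close> adds a telescoping series with sum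
  \<open>1 / real (Suc j)\<close>.\<close>

lemma harm_Suc_minus_sums: "(\<lambda>d. 1 / real (Suc d) - 1 / real (Suc (j + d))) sums harm j"
proof (induction j)
  case 0
  then show ?case by (simp add: harm_def)
next
  case (Suc j)
  have "(\<lambda>d. 1 / real (Suc (j + d)) - 1 / real (Suc (j + Suc d))) sums (1 / real (Suc (j + 0)) - 0)"
    by (rule telescope_sums') real_asymp
  from sums_add[OF Suc this] show ?case
    by (simp add: harm_Suc inverse_eq_divide)
qed

text \<open>The summand at \<open>j = 0\<close> is 0 because \<open>1 / 0 = 0\<close>.\<close>

lemma sum_inverse_eq_harm: "(\<Sum>j<Suc k. 1 / real j) = harm k"
  by (induction k) (simp_all add: harm_Suc harm_expand(1) inverse_eq_divide)

text \<open>Exchange of summation in a nonnegative double series, whose row sums are known from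
  \<open>harm_Suc_minus_sums\<close>.\<close>

lemma sums_shifted_harm:
  fixes z :: "nat \<Rightarrow> real"
  assumes z: "\<And>j. z j \<ge> 0" and s: "(\<lambda>j. z j * harm j) sums s"
  shows "(\<lambda>k. \<Sum>j<k. z j * (1 / real (k - j) - 1 / real k)) sums s"
proof -
  define g where "g = (\<lambda>(j, d). z j * (1 / real (Suc d) - 1 / real (Suc (j + d))))"
  have g_nonneg: "g jd \<ge> 0" for jd
    using z by (auto simp: g_def split_beta intro!: mult_nonneg_nonneg divide_left_mono)
  have row: "((\<lambda>d. g (j, d)) has_sum (z j * harm j)) UNIV" for j
  proof (rule sums_nonneg_imp_has_sum)
    show "(\<lambda>d. g (j, d)) sums (z j * harm j)"
      unfolding g_def by (simp only: prod.case) (rule sums_mult[OF harm_Suc_minus_sums])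
  qed (rule g_nonneg)
  have col: "((\<lambda>j. z j * harm j) has_sum s) UNIV"
    by (rule sums_nonneg_imp_has_sum[OF s]) (use z in \<open>simp add: harm_nonneg\<close>)
  have "(g has_sum s) (Sigma UNIV (\<lambda>_. UNIV))"
    using row col g_nonneg
    by (intro has_sum_SigmaI[where g = "\<lambda>j. z j * harm j"]
        summable_on_SigmaI[where g = "\<lambda>j. z j * harm j"])
      (auto simp: summable_on_def)
  \<comment> \<open>The substitution is \<open>k = j + d + 1\<close>; for fixed \<open>k\<close> the
    index \<open>j\<close> runs over the finitely many \<open>j < k\<close>.\<close>
  also have "?this \<longleftrightarrow> ((\<lambda>(k, j). z j * (1 / real (k - j) - 1 / real k)) has_sum s)
      (Sigma UNIV lessThan)"
    by (rule has_sum_reindex_bij_witness[of _ "\<lambda>(k, j). (j, k - Suc j)"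
        "\<lambda>(j, d). (Suc (j + d), j)"])
      (auto simp: g_def)
  finally have "((\<lambda>k. \<Sum>j<k. z j * (1 / real (k - j) - 1 / real k)) has_sum s) UNIV"
    by (rule has_sum_SigmaD) (simp add: has_sum_finite_iff)
  then show ?thesis by (rule has_sum_imp_sums)
qed

lemma sum_div_harm_le: "(\<Sum>j<k. harm j ^ m / real j) \<le> harm k ^ Suc m"
proof -
  have "(\<Sum>j<k. harm j ^ m / real j) \<le> (\<Sum>j<k. harm k ^ m * (1 / real j))"
    by (intro sum_mono) (auto intro!: divide_right_mono power_mono harm_mono harm_nonneg)
  also have "\<dots> = harm k ^ m * (\<Sum>j<k. 1 / real j)"
    by (simp add: sum_distrib_left)
  also have "\<dots> \<le> harm k ^ m * harm k"
    unfolding sum_inverse_eq_harm[of k, symmetric] by (intro mult_left_mono)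
        (simp_all add: sum_nonneg)
  finally show ?thesis by (simp add: mult.commute)
qed

section \<open>Truncated sums of quasi-shuffle products\<close>

lemma lin_ext_zeta_ps_graft_at_nth:
  "k > 0 \<Longrightarrow> fps_nth (lin_ext zeta_ps (graft_at a F v G)) k = (\<Prod>t\<leftarrow>F. \<Sum>j<k. fps_nth (zeta_ps t) j)
    * (\<Sum>j<k. fps_nth (lin_ext zeta_ps v) j) * (\<Prod>t\<leftarrow>G. \<Sum>j<k. fps_nth (zeta_ps t) j) / real k ^ a"
proof -
  assume k: "k > 0"
  have "linear (\<lambda>f. (\<Prod>t\<leftarrow>F. \<Sum>j<k. fps_nth (zeta_ps t) j) * (\<Sum>j<k. fps_nth f j)
      * (\<Prod>t\<leftarrow>G. \<Sum>j<k. fps_nth (zeta_ps t) j) / real k ^ a)"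
    by (rule linearI) (simp_all add: sum.distrib distrib_left distrib_right add_divide_distrib
        sum_distrib_left[symmetric])
  from linear_lin_ext_apply[OF this, of zeta_ps v] show ?thesis
    using k by (simp add: lin_ext_graft_at linear_lin_ext_apply[OF linear_fps_nth] mult_ac)
qed

lemma lin_ext_zeta_ps_nth_0: "fps_nth (lin_ext zeta_ps p) 0 = 0"
  unfolding linear_lin_ext_apply[OF linear_fps_nth] by (simp add: lin_ext_def)

lemma lin_ext_zeta_ps_qsh_left:
  assumes "Ss \<noteq> [] \<Longrightarrow> (\<Sum>j<k. fps_nth (lin_ext zeta_ps (qsh_tree (last Ss) T)) j)
      = (\<Sum>j<k. fps_nth (zeta_ps (last Ss)) j) * (\<Sum>j<k. fps_nth (zeta_ps T) j)"
  shows "fps_nth (lin_ext zeta_ps (qsh_left (Node a Ss) T)) k = fps_nth (zeta_ps (Node a Ss)) k *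
      (\<Sum>j<k. fps_nth (zeta_ps T) j)"
proof (cases "k = 0")
  case False
  then show ?thesis
    using assms by (cases Ss rule: rev_cases)
      (simp_all add: lin_ext_zeta_ps_graft_at_nth mult_ac del: qsh_tree.simps)
qed (simp add: lin_ext_zeta_ps_nth_0)

lemma lin_ext_zeta_ps_qsh_right:
  assumes "Ts \<noteq> [] \<Longrightarrow> (\<Sum>j<k. fps_nth (lin_ext zeta_ps (qsh_tree S (hd Ts))) j)
      = (\<Sum>j<k. fps_nth (zeta_ps S) j) * (\<Sum>j<k. fps_nth (zeta_ps (hd Ts)) j)"
  shows "fps_nth (lin_ext zeta_ps (qsh_right S (Node b Ts))) k =
      (\<Sum>j<k. fps_nth (zeta_ps S) j) * fps_nth (zeta_ps (Node b Ts)) k"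
proof (cases "k = 0")
  case False
  then show ?thesis
    using assms by (cases Ts) (simp_all add: lin_ext_zeta_ps_graft_at_nth mult_ac
        del: qsh_tree.simps)
qed (simp add: lin_ext_zeta_ps_nth_0)

lemma lin_ext_zeta_ps_qsh_contract:
  assumes "Ss \<noteq> [] \<Longrightarrow> Ts \<noteq> [] \<Longrightarrow> (\<Sum>j<k. fps_nth (lin_ext zeta_ps (qsh_tree (last Ss) (hd Ts))) j)
      = (\<Sum>j<k. fps_nth (zeta_ps (last Ss)) j) * (\<Sum>j<k. fps_nth (zeta_ps (hd Ts)) j)"
  shows "fps_nth (lin_ext zeta_ps (qsh_contract (Node a Ss) (Node b Ts))) k
    = fps_nth (zeta_ps (Node a Ss)) k * fps_nth (zeta_ps (Node b Ts)) k"
proof (cases "k = 0")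
  case False
  then show ?thesis
    using assms by (cases Ss rule: rev_cases; cases Ts)
      (simp_all add: lin_ext_zeta_ps_graft_at_nth mult_ac power_add del: qsh_tree.simps)
qed (simp add: lin_ext_zeta_ps_nth_0)

text \<open>The left, right and contracted products are the three parts of the increment of a
  product of partial sums, which makes truncation multiplicative.\<close>

lemma lin_ext_zeta_ps_qsh_tree:
  "(\<Sum>j<k. fps_nth (lin_ext zeta_ps (qsh_tree S T)) j) = (\<Sum>j<k. fps_nth (zeta_ps S) j) *
      (\<Sum>j<k. fps_nth (zeta_ps T) j)"
proof (induction "size S + size T" arbitrary: S T k rule: less_induct)
  case less
  obtain a Ss where S: "S = Node a Ss" by (cases S)
  obtain b Ts where T: "T = Node b Ts" by (cases T)
  have ihl: "(\<Sum>j<k. fps_nth (lin_ext zeta_ps (qsh_tree (last Ss) T)) j)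
      = (\<Sum>j<k. fps_nth (zeta_ps (last Ss)) j) * (\<Sum>j<k. fps_nth (zeta_ps T) j)" if "Ss \<noteq> []" for k
    using that size_hd_last_less[of Ss] by (intro less.hyps) (auto simp: S)
  have ihr: "(\<Sum>j<k. fps_nth (lin_ext zeta_ps (qsh_tree S (hd Ts))) j)
      = (\<Sum>j<k. fps_nth (zeta_ps S) j) * (\<Sum>j<k. fps_nth (zeta_ps (hd Ts)) j)" if "Ts \<noteq> []" for k
    using that size_hd_last_less[of Ts] by (intro less.hyps) (auto simp: T)
  have ihc: "(\<Sum>j<k. fps_nth (lin_ext zeta_ps (qsh_tree (last Ss) (hd Ts))) j)
      = (\<Sum>j<k. fps_nth (zeta_ps (last Ss)) j) *
          (\<Sum>j<k. fps_nth (zeta_ps (hd Ts)) j)" if "Ss \<noteq> []" "Ts \<noteq> []" for k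
    using that size_hd_last_less[of Ss] size_hd_last_less[of Ts] by (intro less.hyps)
        (auto simp: S T)
  have nth: "fps_nth (lin_ext zeta_ps (qsh_tree S T)) k = fps_nth (zeta_ps S) k *
      (\<Sum>j<k. fps_nth (zeta_ps T) j)
      + (\<Sum>j<k. fps_nth (zeta_ps S) j) * fps_nth (zeta_ps T) k
          + fps_nth (zeta_ps S) k * fps_nth (zeta_ps T) k" for k
    using lin_ext_zeta_ps_qsh_left[OF ihl] lin_ext_zeta_ps_qsh_right[OF ihr]
        lin_ext_zeta_ps_qsh_contract[OF ihc]
    unfolding S T qsh_tree.simps lin_ext_add fps_add_nth by presburger
  show ?case
    by (induction k) (simp_all add: nth algebra_simps del: qsh_tree.simps)
qed

text \<open>The left product contributes \<open>1/j\<close> for \<open>j < k\<close> and the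
  contraction contributes \<open>1/k\<close>; together they give \<open>harm k\<close>.\<close>

lemma lin_ext_zeta_ps_qsh_left_contract_nth:
  "fps_nth (lin_ext zeta_ps (qsh_left S (Node 1 []) + qsh_contract S (Node 1 []))) k
      = fps_nth (zeta_ps S) k * harm k"
proof -
  obtain a Ss where S: "S = Node a Ss" by (cases S)
  have "fps_nth (lin_ext zeta_ps (qsh_left S (Node 1 []) + qsh_contract S (Node 1 []))) k
    = fps_nth (zeta_ps S) k * ((\<Sum>j<k. fps_nth (zeta_ps (Node 1 [])) j)
        + fps_nth (zeta_ps (Node 1 [])) k)"
    using lin_ext_zeta_ps_qsh_left[where Ss = Ss and k = k and T = "Node 1 []" and a
        = a, OF lin_ext_zeta_ps_qsh_tree]
      lin_ext_zeta_ps_qsh_contract[where Ss = Ss and k = k and Ts = "[]" and a = a and b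
          = 1, OF lin_ext_zeta_ps_qsh_tree]
    unfolding S lin_ext_add fps_add_nth by (simp add: distrib_left
        del: zeta_ps.simps qsh_left.simps qsh_contract.simps)
  also have "(\<Sum>j<k. fps_nth (zeta_ps (Node 1 [])) j) + fps_nth (zeta_ps (Node 1 [])) k = harm k"
  proof -
    have "fps_nth (zeta_ps (Node 1 [])) j = 1 / real j" for j by simp
    then show ?thesis using sum_inverse_eq_harm[of k] by (simp del: zeta_ps.simps)
  qed
  finally show ?thesis .
qed

section \<open>The regularisation relation\<close>

lemma prod_list_le_power_nvs:
  fixes f :: "'a ptree \<Rightarrow> real"
  assumes "\<And>t. t \<in> set ts \<Longrightarrow> 0 \<le> f t" "\<And>t. t \<in> set ts \<Longrightarrow> f t \<le> c ^ nv t" "0 \<le> c"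
  shows "(\<Prod>t\<leftarrow>ts. f t) \<le> c ^ nvs ts"
  using assms
proof (induction ts)
  case (Cons t ts)
  then have "f t * (\<Prod>t\<leftarrow>ts. f t) \<le> c ^ nv t * c ^ nvs ts"
    by (intro mult_mono prod_list_nonneg) auto
  then show ?case by (simp add: power_add)
qed simp

text \<open>Each vertex other than the root costs at most one factor \<open>harm k\<close>, by
  \<open>sum_div_harm_le\<close>.\<close>

lemma zeta_ps_le: "t \<in> PT pos_nats \<Longrightarrow> fps_nth (zeta_ps t) k \<le> harm k ^ (nv t - 1) / real k ^ label t"
proof (induction t arbitrary: k)
  case (Node n ts)
  have "(\<Sum>j<k. fps_nth (zeta_ps t) j) \<le> harm k ^ nv t" if t: "t \<in> set ts" for t
  proof -
    have pt: "t \<in> PT pos_nats" using Node.prems t by (auto simp: PT_def)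
    then have l: "label t \<ge> 1" by (cases t) (auto simp: PT_def pos_nats_def)
    have "fps_nth (zeta_ps t) j \<le> harm j ^ (nv t - 1) / real j" for j
    proof (cases "j = 0")
      case False
      have "harm j ^ (nv t - 1) / real j ^ label t \<le> harm j ^ (nv t - 1) / real j"
        using False l self_le_power[of "real j" "label t"]
        by (intro divide_left_mono) (auto simp: harm_nonneg)
      then show ?thesis using Node.IH[OF t pt, of j] by linarith
    qed simp
    then have "(\<Sum>j<k. fps_nth (zeta_ps t) j) \<le> (\<Sum>j<k. harm j ^ (nv t - 1) / real j)"
      by (intro sum_mono)
    also have "\<dots> \<le> harm k ^ Suc (nv t - 1)" by (rule sum_div_harm_le)
    also have "Suc (nv t - 1) = nv t" by (cases t) simp
    finally show ?thesis .
  qed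
  then have "(\<Prod>t\<leftarrow>ts. \<Sum>j<k. fps_nth (zeta_ps t) j) \<le> harm k ^ nvs ts"
    by (intro prod_list_le_power_nvs) (auto intro: sum_nonneg zeta_ps_nonneg harm_nonneg)
  then show ?case
    by (cases "k = 0") (auto intro: divide_right_mono simp: harm_expand(1))
qed

text \<open>A root decoration of at least 2 leaves a power of harmonic numbers over
  \<open>k^2\<close>; one further factor \<open>harm k\<close> does no harm.\<close>

lemma summable_zeta_ps_harm:
  assumes "T \<in> conv_trees"
  shows "summable (\<lambda>k. fps_nth (zeta_ps T) k * harm k)" "summable (\<lambda>k. fps_nth (zeta_ps T) k)"
proof -
  have T: "T \<in> PT pos_nats" "label T \<ge> 2"
    using assms by (cases T; force simp: conv_trees_def PT_def pos_nats_def)+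
  have le: "fps_nth (zeta_ps T) k \<le> harm k ^ (nv T - 1) / real k ^ 2" for k
  proof (cases "k = 0")
    case False
    then have "harm k ^ (nv T - 1) / real k ^ label T \<le> harm k ^ (nv T - 1) / real k ^ 2"
      using T(2) by (intro divide_left_mono power_increasing) (auto simp: harm_nonneg)
    then show ?thesis using zeta_ps_le[OF T(1), of k] by linarith
  qed simp
  then show "summable (\<lambda>k. fps_nth (zeta_ps T) k)"
    by (intro summable_comparison_test'[OF summable_harm_power[of "nv T - 1"]])
        (simp add: zeta_ps_nonneg)
  have "norm (fps_nth (zeta_ps T) k * harm k) \<le> harm k ^ nv T / real k ^ 2" for k
    using mult_right_mono[OF le[of k] harm_nonneg[of k]]
    by (cases T) (simp add: zeta_ps_nonneg harm_nonneg abs_mult mult_ac del: zeta_ps.simps)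
  then show "summable (\<lambda>k. fps_nth (zeta_ps T) k * harm k)"
    by (intro summable_comparison_test'[OF summable_harm_power[of "nv T"]])
qed

section \<open>Zeta values through coefficient sequences\<close>

lemma zetaT_sums:
  assumes "p \<in> span_over K conv_trees"
  shows "(\<lambda>k. fps_nth (lin_ext zeta_ps p) k) sums zetaT p"
proof -
  have "(\<lambda>k. fps_nth (zeta_ps t) k) sums zeta_tree t" if "t \<in> Poly_Mapping.keys p" for t
  proof -
    have "(\<lambda>k. fps_nth (zeta_ps t) k) sums suminf (\<lambda>k. fps_nth (zeta_ps t) k)"
      using that assms by (intro summable_sums summable_zeta_ps_harm) (auto simp: span_over_def)
    then show ?thesis using zeta_tree_eqI[of t] by simp
  qed
  then have "(\<lambda>k. \<Sum>t\<in>Poly_Mapping.keys p. Poly_Mapping.lookup p t *\<^sub>R fps_nth (zeta_ps t) k) sums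
      zetaT p"
    unfolding zetaT_def lin_ext_def by (intro sums_sum sums_scaleR_right)
  then show ?thesis
    by (simp add: lin_ext_def fps_sum_nth)
qed

lemma lin_ext_Li_sPT:
  assumes "p \<in> span_over K (PT pos_nats)"
  shows "lin_ext Li (sPT p) = lin_ext zeta_ps p"
proof -
  have "lin_ext Li (sPT p) = lin_ext (\<lambda>t. lin_ext Li (sPT (basis_vec t))) p"
    using linear_eq_lin_ext[OF linear_compose[OF linear_sPT linear_lin_ext]] by (simp add: comp_def)
  also have "\<dots> = lin_ext zeta_ps p"
    unfolding lin_ext_Li_sPT_basis
    by (rule lin_ext_cong) (use assms lin_ext_Li_phi_tree in \<open>auto simp: span_over_def\<close>)
  finally show ?thesis .
qed

text \<open>The left half is the full shuffle minus the right half, and the latter only grafts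
  \<open>s\<close> on a root \<open>Y\<close>.\<close>

lemma lin_ext_Li_sh_left_Y:
  assumes "q \<in> span_over K {s. Y_branched s}"
  shows "lin_ext Li (lin_ext (\<lambda>s. sh_left s (Node Y [])) q)
    = lin_ext Li q * Li (Node Y []) - euler_int (geom_tail * lin_ext Li q)"
proof -
  have lin: "linear (\<lambda>f. f * Li (Node Y []) - euler_int (geom_tail * f))"
    by (rule linearI) (simp_all add: distrib_left distrib_right fps_mult_scaleR_left
        fps_mult_scaleR_right
        euler_int_simps scaleR_diff_right)
  have "lin_ext Li (sh_left s (Node Y [])) = Li s * Li (Node Y []) - euler_int (geom_tail * Li s)"
    if "Y_branched s" for s
    using lin_ext_Li_sh_tree[OF that, of "Node Y []"] by (simp add: letter_kernel_def algebra_simps)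
  then have "lin_ext Li (lin_ext (\<lambda>s. sh_left s (Node Y [])) q)
      = lin_ext (\<lambda>s. Li s * Li (Node Y []) - euler_int (geom_tail * Li s)) q"
    unfolding linear_lin_ext_apply[OF linear_lin_ext]
    by (intro lin_ext_cong) (use assms in \<open>auto simp: span_over_def\<close>)
  then show ?thesis
    unfolding linear_lin_ext_apply[OF lin] .
qed

text \<open>\<open>Li (Node Y [])\<close> is the series of \<open>-log(1-t)\<close>, with
  coefficients \<open>1/k\<close>. The first term is a convolution with it, the second a partial sum
  divided by \<open>k\<close>.\<close>

lemma Li_half_shuffle_nth:
  "fps_nth (f * Li (Node Y []) - euler_int (geom_tail * f)) k
    = (\<Sum>j<k. fps_nth f j * (1 / real (k - j) - 1 / real k))"
proof -
  have "fps_nth (f * Li (Node Y [])) k = (\<Sum>j<k. fps_nth f j / real (k - j))"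
    unfolding fps_mult_nth
    by (rule sum.mono_neutral_cong_right) (auto simp: letter_kernel_def geom_tail_def)
  then show ?thesis
    by (simp add: geom_tail_mult_nth sum_subtractf sum_divide_distrib right_diff_distrib
        del: Li.simps)
qed

section \<open>Convergence of the left and contracted products\<close>

lemma qsh_left_in_span:
  assumes K: "real_subfield K" and "T \<in> PT pos_nats"
  shows "qsh_left T (Node 1 []) \<in> span_over K {u \<in> PT pos_nats. label u = label T}"
  using assms(2)
proof (induction T)
  case (Node a ts)
  show ?case
  proof (cases "ts = []")
    case True
    then show ?thesis using Node.prems
      by (auto intro!: span_over_basis_vec[OF K] simp: Node_in_PT_iff pos_nats_def)
  next
    case False
    let ?s = "last ts"
    obtain b us where s: "?s = Node b us" by (cases ?s)
    have pt: "?s \<in> set ts" "?s \<in> PT pos_nats" using False Node.prems last_in_set[of ts] by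
        (auto simp: Node_in_PT_iff)
    have "qsh_left ?s (Node 1 []) \<in> span_over K (PT pos_nats)"
      by (rule span_over_mono[OF K _ Node.IH]) (use pt in auto)
    moreover have "Node 1 [?s] \<in> PT pos_nats" "Node (b + 1) us \<in> PT pos_nats"
      using pt unfolding s by (auto simp: Node_in_PT_iff pos_nats_def)
    ultimately have "qsh_tree ?s (Node 1 []) \<in> span_over K (PT pos_nats)"
      unfolding s by (auto intro!: span_over_add[OF K] span_over_basis_vec[OF K] simp
          del: qsh_left.simps)
    then have "graft_at a (butlast ts) (qsh_tree ?s (Node 1 [])) []
        \<in> span_over K {u \<in> PT pos_nats. label u = a}"
      by (rule span_over_graft_at[OF K]) (use Node.prems in \<open>auto
          simp: Node_in_PT_iff dest: in_set_butlastD\<close>)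
    then show ?thesis using False by (simp del: qsh_tree.simps)
  qed
qed

lemma qsh_left_contract_conv:
  assumes K: "real_subfield K" and T: "T \<in> conv_trees"
  shows "qsh_left T (Node 1 []) + qsh_contract T (Node 1 []) \<in> span_over K conv_trees"
proof (intro span_over_add[OF K])
  show "qsh_left T (Node 1 []) \<in> span_over K conv_trees"
    by (rule span_over_mono[OF K _ qsh_left_in_span[OF K]]) (use T in \<open>auto simp: conv_trees_def\<close>)
  obtain a Ss where S: "T = Node a Ss" by (cases T)
  show "qsh_contract T (Node 1 []) \<in> span_over K conv_trees"
    using T unfolding S
    by (auto intro!: span_over_basis_vec[OF K] simp: conv_trees_def Node_in_PT_iff pos_nats_def)
qed

theorem theorem53:
  fixes K :: "real set" and T :: "nat ptree"
  assumes "real_subfield K"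
    and "T \<in> conv_trees"
  shows "qsh (basis_vec T) (basis_vec (Node 1 []))
      - inv_into (span_over K (PT pos_nats)) sPT (sh (sPT (basis_vec T)) (basis_vec (Node Y [])))
      \<in> ker_zetaT K"
proof -
  note K = assms(1)
  obtain U where U: "U \<in> span_over K conv_trees"
    "sPT U = lin_ext (\<lambda>s. sh_left s (Node Y [])) (sPT (basis_vec T))"
    "inv_into (span_over K (PT pos_nats)) sPT (sh (sPT (basis_vec T)) (basis_vec (Node Y [])))
      = basis_vec (Node 1 [T]) + U"
    using sh_sPT_inverse[OF assms] .
  let ?V = "qsh_left T (Node 1 []) + qsh_contract T (Node 1 [])"
  have V: "?V \<in> span_over K conv_trees"
    by (rule qsh_left_contract_conv[OF assms])
  have PT: "T \<in> PT pos_nats" "U \<in> span_over K (PT pos_nats)"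
    using assms(2) span_over_mono[OF K _ U(1), of "PT pos_nats"] by (auto simp: conv_trees_def)
  \<comment> \<open>The right product with \<open>[1]\<close> is the divergent tree
    \<open>Node 1 [T]\<close>, which also occurs in \<open>U(3)\<close> and cancels.\<close>
  have "qsh (basis_vec T) (basis_vec (Node 1 [])) = ?V + basis_vec (Node 1 [T])"
    by (simp add: qsh_def bilin_ext_def add_ac)
  then have eq: "qsh (basis_vec T) (basis_vec (Node 1 []))
      - inv_into (span_over K (PT pos_nats)) sPT (sh (sPT (basis_vec T)) (basis_vec (Node Y [])))
          = ?V - U"
    unfolding U(3) by simp
  \<comment> \<open>\<open>s\<close> is the common zeta value of \<open>?V\<close> and
    \<open>U\<close>.\<close>
  obtain s where s: "(\<lambda>k. fps_nth (zeta_ps T) k * harm k) sums s"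
    using summable_zeta_ps_harm(1)[OF assms(2)] by (auto simp: summable_def)
  have "(\<lambda>k. fps_nth (lin_ext zeta_ps ?V) k) sums s"
    unfolding lin_ext_zeta_ps_qsh_left_contract_nth by (rule s)
  then have "zetaT ?V = s"
    using zetaT_sums[OF V] by (rule sums_unique2[symmetric])
  \<comment> \<open>The series of \<open>U\<close> is read off from \<open>sPT U\<close>, so
    \<open>U\<close> itself need not be computed.\<close>
  have "lin_ext zeta_ps U = zeta_ps T * Li (Node Y []) - euler_int (geom_tail * zeta_ps T)"
    using lin_ext_Li_sPT[OF PT(2)] lin_ext_Li_sPT[OF span_over_basis_vec[OF K PT(1)]]
      lin_ext_Li_sh_left_Y[OF span_over_mono[OF K _ sPT_in_span[OF assms]]]
    unfolding U(2) by (auto simp del: Li.simps zeta_ps.simps)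
  then have "(\<lambda>k. fps_nth (lin_ext zeta_ps U) k) sums s"
    using sums_shifted_harm[OF zeta_ps_nonneg s] by (simp only: Li_half_shuffle_nth)
  then have "zetaT U = s"
    using zetaT_sums[OF U(1)] by (rule sums_unique2[symmetric])
  with \<open>zetaT ?V = s\<close> have "zetaT (?V - U) = 0"
    unfolding zetaT_def by (simp del: qsh_left.simps qsh_contract.simps)
  then show ?thesis
    unfolding eq ker_zetaT_def using span_over_diff[OF K V U(1)] by simp
qed

end
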